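(* Let $\alpha\in(0,1)$, $C\ge2$, $\rho_0\in[0,1]$, and $\Phi(c_{\alpha/2})=1-\alpha/2$. Let $S$ be a (random) sampling procedure allocating data to $C$ tests such that, under the global null and conditionally on the draw of $S$, the test statistics $(T_1,\dots,T_C)$ are jointly normal with $T_i\sim\mathcal N(0,1)$ and pairwise correlations $\rho_{ij}$ (which depend on the draw of $S$). Let $R_i=\{|T_i|>c_{\alpha/2}\}$ and $E=\sum_{i=1}^C\mathbf 1_{R_i}$. Suppose that $\mathbb P_S(|\rho_{ij}|\ge\rho_0)\le w$ for all $i\neq j$. Then $$\mathrm{EVR}(S)\le1+\frac{C-1}{\alpha(1-\alpha)}\left[\alpha(1-\alpha)\,w+R(\rho_0,c_{\alpha/2})\right],$$ where $R(\rho_0,c_{\alpha/2})=2\left[\Phi_{\rho_0}(c_{\alpha/2},c_{\alpha/2})+\Phi_{-\rho_0}(c_{\alpha/2},c_{\alpha/2})-2\Phi(c_{\alpha/2})^2\right]$.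
   Context: The expected variance ratio is $\mathrm{EVR}(S)=\dfrac{\mathbb E_S[\mathbb V(E)]}{C\alpha(1-\alpha)}$, where $\mathbb V(E)$ is the conditional variance of $E$ given the draw of $S$, and $\mathbb E_S,\mathbb P_S$ are expectation and probability over the draw of $S$. $\Phi$ is the standard normal CDF and $\Phi_\rho(x,y)$ the CDF of the bivariate normal law with zero means, unit variances and correlation $\rho$ (degenerate if $|\rho|=1$). *)

theory Defs
  imports "HOL-Probability.Probability"
begin

section \<open>Normal laws\<close>

definition std_normal_cdf :: "real \<Rightarrow> real" where
  "std_normal_cdf x = cdf std_normal_distribution x"

text \<open>The bivariate normal law with zero means, unit variances and correlation \<open>\<rho>\<close>, for
  \<open>\<bar>\<rho>\<bar> \<le> 1\<close>, is the law of \<open>(Z, \<rho> Z + sqrt (1 - \<rho>\<^sup>2) W)\<close> with \<open>Z\<close>, \<open>W\<close> independent standard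
  normal. This covers the degenerate cases \<open>\<bar>\<rho>\<bar> = 1\<close>, where it is the law of \<open>(Z, \<rho> Z)\<close>.\<close>

definition bivariate_std_normal :: "real \<Rightarrow> (real \<times> real) measure" where
  "bivariate_std_normal \<rho> =
     distr (std_normal_distribution \<Otimes>\<^sub>M std_normal_distribution) (borel \<Otimes>\<^sub>M borel)
       (\<lambda>(z, w). (z, \<rho> * z + sqrt (1 - \<rho>\<^sup>2) * w))"

definition bivariate_std_normal_cdf :: "real \<Rightarrow> real \<Rightarrow> real \<Rightarrow> real" where
  "bivariate_std_normal_cdf \<rho> x y = measure (bivariate_std_normal \<rho>) ({..x} \<times> {..y})"

text \<open>Normal laws on the line, point masses (\<open>\<sigma> = 0\<close>) included.\<close>

definition normal_law :: "real \<Rightarrow> real \<Rightarrow> real measure" where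
  "normal_law m \<sigma> = (if \<sigma> = 0 then return borel m else density lborel (normal_density m \<sigma>))"

text \<open>A law on the functions on a finite index set is jointly normal if every linear combination
  of the coordinates is normal; singular covariance matrices are allowed.\<close>

definition jointly_normal :: "'i set \<Rightarrow> ('i \<Rightarrow> real) measure \<Rightarrow> bool" where
  "jointly_normal I \<mu> \<longleftrightarrow>
     (\<forall>a. \<exists>m \<sigma>. \<sigma> \<ge> 0 \<and> distr \<mu> borel (\<lambda>x. \<Sum>i\<in>I. a i * x i) = normal_law m \<sigma>)"


section \<open>Covariance and correlation\<close>

definition covariance :: "'a measure \<Rightarrow> ('a \<Rightarrow> real) \<Rightarrow> ('a \<Rightarrow> real) \<Rightarrow> real" where
  "covariance M X Y =
     (\<integral>\<omega>. (X \<omega> - (\<integral>\<omega>'. X \<omega>' \<partial>M)) * (Y \<omega> - (\<integral>\<omega>'. Y \<omega>' \<partial>M)) \<partial>M)"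

definition correlation :: "'a measure \<Rightarrow> ('a \<Rightarrow> real) \<Rightarrow> ('a \<Rightarrow> real) \<Rightarrow> real" where
  "correlation M X Y = covariance M X Y / (sqrt (covariance M X X) * sqrt (covariance M Y Y))"


section \<open>Conditioning on the draw of the sampling procedure\<close>

text \<open>\<open>K\<close> is a regular conditional distribution of \<open>X\<close>, valued in \<open>L\<close>, given \<open>S\<close>, valued in \<open>N\<close>:
  a Markov kernel with \<open>P(S \<in> B, X \<in> A) = \<integral>\<^sub>B K s A P\<^sub>S(ds)\<close>, where \<open>P\<^sub>S\<close> is the law of \<open>S\<close>.\<close>

definition regular_cond_distr ::
  "'a measure \<Rightarrow> 's measure \<Rightarrow> 'b measure \<Rightarrow> ('a \<Rightarrow> 's) \<Rightarrow> ('a \<Rightarrow> 'b) \<Rightarrow> ('s \<Rightarrow> 'b measure) \<Rightarrow> bool"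
where
  "regular_cond_distr M N L S X K \<longleftrightarrow>
     K \<in> N \<rightarrow>\<^sub>M prob_algebra L \<and>
     (\<forall>B\<in>sets N. \<forall>A\<in>sets L.
        emeasure M {\<omega>\<in>space M. S \<omega> \<in> B \<and> X \<omega> \<in> A} =
          (\<integral>\<^sup>+s\<in>B. emeasure (K s) A \<partial>(distr M N S)))"

definition sigma_gen :: "'a measure \<Rightarrow> 's measure \<Rightarrow> ('a \<Rightarrow> 's) \<Rightarrow> 'a measure" where
  "sigma_gen M N S = vimage_algebra (space M) S N"

definition cond_variance :: "'a measure \<Rightarrow> 'a measure \<Rightarrow> ('a \<Rightarrow> real) \<Rightarrow> 'a \<Rightarrow> real" where
  "cond_variance M F X = real_cond_exp M F (\<lambda>\<omega>. (X \<omega> - real_cond_exp M F X \<omega>)\<^sup>2)"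


section \<open>Rejection counts and the expected variance ratio\<close>

definition reject :: "'a measure \<Rightarrow> (nat \<Rightarrow> 'a \<Rightarrow> real) \<Rightarrow> real \<Rightarrow> nat \<Rightarrow> 'a set" where
  "reject M T c i = {\<omega>\<in>space M. \<bar>T i \<omega>\<bar> > c}"

definition num_rejections ::
  "'a measure \<Rightarrow> nat \<Rightarrow> (nat \<Rightarrow> 'a \<Rightarrow> real) \<Rightarrow> real \<Rightarrow> 'a \<Rightarrow> real" where
  "num_rejections M C T c \<omega> = (\<Sum>i=1..C. indicator (reject M T c i) \<omega>)"

text \<open>The conditional variance is a function of the draw of \<open>S\<close> (up to null sets), so its
  expectation over the draw is its expectation under \<open>M\<close>.\<close>

definition EVR ::
  "'a measure \<Rightarrow> 's measure \<Rightarrow> ('a \<Rightarrow> 's) \<Rightarrow> nat \<Rightarrow> real \<Rightarrow> ('a \<Rightarrow> real) \<Rightarrow> real" where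
  "EVR M N S C \<alpha> E =
     (\<integral>\<omega>. cond_variance M (sigma_gen M N S) E \<omega> \<partial>M) / (real C * \<alpha> * (1 - \<alpha>))"

definition R_bound :: "real \<Rightarrow> real \<Rightarrow> real" where
  "R_bound \<rho> c =
     2 * (bivariate_std_normal_cdf \<rho> c c + bivariate_std_normal_cdf (- \<rho>) c c
            - 2 * (std_normal_cdf c)\<^sup>2)"

end

theory Submission
  imports Defs
begin

text \<open>Given the draw of \<open>S\<close>, every test rejects with probability \<open>\<alpha>\<close>, so the conditional mean of the
  rejection count is the constant \<open>C * \<alpha>\<close>, and the expected conditional variance is the sum over
  all pairs of tests of the probability of joint rejection, minus \<open>(C * \<alpha>)\<^sup>2\<close>. Given the draw, a pair
  of statistics has a standard bivariate normal law, determined by its correlation \<open>r\<close>, and the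
  probability of joint rejection is \<open>\<alpha>\<^sup>2 + R_bound r c\<close>. It is an even function of \<open>r\<close>, at most \<open>\<alpha>\<close>,
  and increasing in \<open>\<bar>r\<bar>\<close> by Jensen's inequality. Hence it is at most \<open>\<alpha>\<^sup>2 + R_bound \<rho>0 c\<close> where
  \<open>\<bar>r\<bar> < \<rho>0\<close>, and on the remaining draws, of probability at most \<open>w\<close>, at most \<open>\<alpha>\<close>.\<close>

section \<open>Uniqueness of finite measures with equal Fourier transforms\<close>

text \<open>The transform at \<open>0\<close> is the total mass, so both measures have the same mass
  \<open>m\<close>. If \<open>m\<close> is positive, dividing by it reduces the claim to Levy's
  uniqueness theorem for probability laws; if \<open>m = 0\<close>, both measures vanish.\<close>

lemma finite_char_unique:
  fixes \<mu> \<nu> :: "real measure"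
  assumes fin: "finite_measure \<mu>" "finite_measure \<nu>"
    and sets[measurable_cong, simp]: "sets \<mu> = sets borel" "sets \<nu> = sets borel"
    and eq: "\<And>t. char \<mu> t = char \<nu> t"
  shows "\<mu> = \<nu>"
proof -
  interpret \<mu>: finite_measure \<mu> by fact
  interpret \<nu>: finite_measure \<nu> by fact
  have sp[simp]: "space \<mu> = UNIV" "space \<nu> = UNIV"
    using sets[THEN sets_eq_imp_space_eq] by auto
  define m where "m = measure \<mu> UNIV"
  have m': "m = measure \<nu> UNIV"
    using eq[of 0] by (simp add: char_def m_def)
  have eM: "emeasure \<mu> UNIV = ennreal m" "emeasure \<nu> UNIV = ennreal m"
    by (simp_all add: m_def \<mu>.emeasure_eq_measure) (simp add: m'[unfolded m_def] \<nu>.emeasure_eq_measure)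
  show ?thesis
  proof (cases "m = 0")
    case True
    have "emeasure \<mu> A = 0" "emeasure \<nu> A = 0" for A
      using emeasure_space[of \<mu> A] emeasure_space[of \<nu> A] eM True by auto
    then show ?thesis by (intro measure_eqI) auto
  next
    case False
    then have m: "m > 0" by (simp add: m_def measure_nonneg order_less_le)
    define \<mu>' \<nu>' where "\<mu>' = density \<mu> (\<lambda>_. ennreal (1 / m))" and "\<nu>' = density \<nu> (\<lambda>_. ennreal (1 / m))"
    have em: "emeasure \<mu>' A = ennreal (1/m) * emeasure \<mu> A" "emeasure \<nu>' A = ennreal (1/m) * emeasure \<nu> A"
      if "A \<in> sets borel" for A
      using that by (auto simp: \<mu>'_def \<nu>'_def emeasure_density nn_integral_cmult_indicator)
    have "real_distribution \<mu>'" "real_distribution \<nu>'"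
      unfolding real_distribution_def real_distribution_axioms_def
      using m em[of UNIV] eM
      by (auto intro!: prob_spaceI simp: \<mu>'_def \<nu>'_def ennreal_mult'[symmetric])
    moreover have "char \<mu>' t = char \<nu>' t" for t
      using m eq[of t] by (simp add: char_def \<mu>'_def \<nu>'_def integral_density)
    ultimately have *: "\<mu>' = \<nu>'" by (intro Levy_uniqueness) auto
    show ?thesis
    proof (rule measure_eqI)
      fix A assume "A \<in> sets \<mu>"
      then have A: "A \<in> sets borel" by simp
      have "ennreal m * (ennreal (1/m) * emeasure \<mu> A) = ennreal m * (ennreal (1/m) * emeasure \<nu> A)"
        using em[OF A] * by simp
      then show "emeasure \<mu> A = emeasure \<nu> A"
        using m by (simp add: mult.assoc[symmetric] ennreal_mult'[symmetric])
    qed simp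
  qed
qed

text \<open>Each integral is the mass of \<open>B\<close> under the image by \<open>f\<close> of the
  measure with density \<open>k\<close>. Since \<open>k\<close> is nonnegative and bounded, these
  images are finite measures, and the hypothesis \<open>eq\<close> says that their transforms
  agree.\<close>

lemma weighted_law_unique:
  fixes \<mu> \<nu> :: "'a measure" and k f :: "'a \<Rightarrow> real"
  assumes fin: "finite_measure \<mu>" "finite_measure \<nu>"
    and s[simp]: "sets \<nu> = sets \<mu>"
    and k[measurable]: "k \<in> borel_measurable \<mu>" and f[measurable]: "f \<in> borel_measurable \<mu>"
    and k_bound: "\<And>z. 0 \<le> k z" "\<And>z. k z \<le> D"
    and eq: "\<And>t. (CLINT z|\<mu>. complex_of_real (k z) * iexp (t * f z)) =
                  (CLINT z|\<nu>. complex_of_real (k z) * iexp (t * f z))"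
    and B[measurable]: "B \<in> sets borel"
  shows "(\<integral>z. k z * indicator B (f z) \<partial>\<mu>) = (\<integral>z. k z * indicator B (f z) \<partial>\<nu>)"
proof -
  note [measurable_cong] = s
  define L where "L = (\<lambda>\<kappa>::'a measure. distr (density \<kappa> (\<lambda>z. ennreal (k z))) borel f)"
  have L: "finite_measure (L \<kappa>) \<and> char (L \<kappa>) t = (CLINT z|\<kappa>. complex_of_real (k z) * iexp (t * f z))
      \<and> (\<integral>z. k z * indicator B (f z) \<partial>\<kappa>) = measure (L \<kappa>) B"
    if fin: "finite_measure \<kappa>" and [measurable_cong]: "sets \<kappa> = sets \<mu>" for \<kappa> t
  proof -
    interpret finite_measure \<kappa> by fact
    have [measurable]: "k \<in> borel_measurable \<kappa>" "f \<in> borel_measurable \<kappa>" by measurable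
    have [simp]: "integrable \<kappa> k"
      by (rule integrable_const_bound[of _ D]) (use k_bound in auto)
    have "finite_measure (density \<kappa> (\<lambda>z. ennreal (k z)))"
      by (rule finite_measureI) (simp add: emeasure_density nn_integral_eq_integral k_bound
        cong: nn_integral_cong_simp)
    then have 1: "finite_measure (L \<kappa>)"
      unfolding L_def by (intro finite_measure.finite_measure_distr) auto
    have 2: "char (L \<kappa>) t = (CLINT z|\<kappa>. complex_of_real (k z) * iexp (t * f z))"
      unfolding L_def char_def
      by (simp add: integral_distr integral_density k_bound scaleR_conv_of_real)
    have "measure (L \<kappa>) B = (\<integral>x. indicator B x \<partial>L \<kappa>)"
      by (simp add: L_def)
    also have "\<dots> = (\<integral>z. k z * indicator B (f z) \<partial>\<kappa>)"
      unfolding L_def by (simp add: integral_distr integral_density k_bound del: Bochner_Integration.integral_indicator integral_indicator)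
    finally show ?thesis using 1 2 by simp
  qed
  have "L \<mu> = L \<nu>"
    using L[OF fin(1) refl] L[OF fin(2) s] eq
    by (intro finite_char_unique) (auto simp: L_def)
  then show ?thesis using L[OF fin(1) refl] L[OF fin(2) s] by metis
qed

text \<open>The transforms determine, for fixed \<open>t\<close>, the law of the second coordinate weighted by the
  nonnegative functions \<open>1 + cos (t * x)\<close> and \<open>1 + sin (t * x)\<close> of the first. This gives the transform
  in \<open>x\<close> weighted by \<open>y \<in> B\<close>, so that two applications of the one-dimensional theorem suffice.\<close>

lemma char2_unique:
  fixes \<mu> \<nu> :: "(real \<times> real) measure"
  assumes fin: "finite_measure \<mu>" "finite_measure \<nu>"
    and s[measurable_cong, simp]: "sets \<mu> = sets (borel \<Otimes>\<^sub>M borel)" "sets \<nu> = sets (borel \<Otimes>\<^sub>M borel)"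
    and eq: "\<And>a b. (CLINT z|\<mu>. iexp (a * fst z + b * snd z)) = (CLINT z|\<nu>. iexp (a * fst z + b * snd z))"
  shows "\<mu> = \<nu>"
proof -
  interpret \<mu>: finite_measure \<mu> by fact
  interpret \<nu>: finite_measure \<nu> by fact
  have [simp]: "space \<mu> = UNIV" "space \<nu> = UNIV"
    using s[THEN sets_eq_imp_space_eq] by (auto simp: space_pair_measure)
  have bi\<mu>: "integrable \<mu> g" if "g \<in> borel_measurable (borel \<Otimes>\<^sub>M borel)" "\<And>z. norm (g z) \<le> 2"
    for g :: "_ \<Rightarrow> 'b::{banach,second_countable_topology}"
    by (rule \<mu>.integrable_const_bound[of _ 2]) (use that in auto)
  have bi\<nu>: "integrable \<nu> g" if "g \<in> borel_measurable (borel \<Otimes>\<^sub>M borel)" "\<And>z. norm (g z) \<le> 2"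
    for g :: "_ \<Rightarrow> 'b::{banach,second_countable_topology}"
    by (rule \<nu>.integrable_const_bound[of _ 2]) (use that in auto)
  \<comment> \<open>Trigonometric weights are combinations of exponentials, so the hypothesis at
    \<open>(t, r)\<close> and \<open>(- t, r)\<close> yields the weighted transforms.\<close>
  have cos_eq: "complex_of_real (cos (t * x)) * iexp (r * y) =
     (iexp (t * x + r * y) + iexp (- t * x + r * y)) / 2" for t x r y
    by (simp add: cos_of_real[symmetric] cos_exp_eq exp_add[symmetric] algebra_simps add_divide_distrib)
  have sin_eq: "complex_of_real (sin (t * x)) * iexp (r * y) =
     (iexp (t * x + r * y) - iexp (- t * x + r * y)) / (2 * \<i>)" for t x r y
    by (simp add: sin_of_real[symmetric] sin_exp_eq exp_add[symmetric] algebra_simps diff_divide_distrib)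
  have c0: "(CLINT z|\<mu>. iexp (r * snd z)) = (CLINT z|\<nu>. iexp (r * snd z))" for r
    using eq[of 0 r] by simp
  have cc: "(CLINT z|\<mu>. complex_of_real (cos (t * fst z)) * iexp (r * snd z)) =
      (CLINT z|\<nu>. complex_of_real (cos (t * fst z)) * iexp (r * snd z))" for t r
    unfolding cos_eq using eq[of t r] eq[of "- t" r]
    by (simp add: bi\<mu> bi\<nu>)
  have cs: "(CLINT z|\<mu>. complex_of_real (sin (t * fst z)) * iexp (r * snd z)) =
      (CLINT z|\<nu>. complex_of_real (sin (t * fst z)) * iexp (r * snd z))" for t r
    unfolding sin_eq using eq[of t r] eq[of "- t" r]
    by (simp add: bi\<mu> bi\<nu>)
  have rect: "emeasure \<mu> (A \<times> B) = emeasure \<nu> (A \<times> B)"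
    if [measurable]: "A \<in> sets borel" "B \<in> sets borel" for A B
  proof -
    have w: "(\<integral>z. k z * indicator B (snd z) \<partial>\<mu>) = (\<integral>z. k z * indicator B (snd z) \<partial>\<nu>)"
      if [measurable]: "k \<in> borel_measurable (borel \<Otimes>\<^sub>M borel)"
        and "\<And>z. 0 \<le> k z" "\<And>z. k z \<le> 2"
        and "\<And>r. (CLINT z|\<mu>. complex_of_real (k z) * iexp (r * snd z)) =
                  (CLINT z|\<nu>. complex_of_real (k z) * iexp (r * snd z))" for k
      by (rule weighted_law_unique[where D=2]) (use that fin in auto)
    have w0: "(\<integral>z. indicator B (snd z) \<partial>\<mu>) = (\<integral>z. indicator B (snd z) \<partial>\<nu> :: real)"
      using w[of "\<lambda>_. 1"] c0 by simp
    have wu: "(\<integral>z. u z * indicator B (snd z) \<partial>\<mu>) = (\<integral>z. u z * indicator B (snd z) \<partial>\<nu>)"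
      if u[measurable]: "u \<in> borel_measurable (borel \<Otimes>\<^sub>M borel)" and u1: "\<And>z. \<bar>u z\<bar> \<le> 1"
        and ue: "\<And>r. (CLINT z|\<mu>. complex_of_real (u z) * iexp (r * snd z)) =
                  (CLINT z|\<nu>. complex_of_real (u z) * iexp (r * snd z))" for u
    proof -
      have u2: "\<bar>u z\<bar> \<le> 2" "-1 \<le> u z" "u z \<le> 1" for z using u1[of z] by linarith+
      have dist: "complex_of_real (1 + u z) * v = v + complex_of_real (u z) * v"
        "(1 + u z) * r = r + u z * r" for z v r
        by (simp_all add: ring_distribs)
      have [simp]: "integrable \<mu> (\<lambda>z. complex_of_real (u z) * iexp (r * snd z))"
        "integrable \<nu> (\<lambda>z. complex_of_real (u z) * iexp (r * snd z))"
        "integrable \<mu> (\<lambda>z. iexp (r * snd z))" "integrable \<nu> (\<lambda>z. iexp (r * snd z))" for r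
        using u2 by (auto intro!: bi\<mu> bi\<nu> simp: norm_mult simp del: of_real_mult)
      have [simp]: "integrable \<mu> (\<lambda>z. u z * indicator B (snd z))"
        "integrable \<nu> (\<lambda>z. u z * indicator B (snd z))"
        "integrable \<mu> (\<lambda>z. indicator B (snd z) :: real)" "integrable \<nu> (\<lambda>z. indicator B (snd z) :: real)"
        using u2 by (auto intro!: bi\<mu> bi\<nu> simp: indicator_def)
      have "(\<integral>z. (1 + u z) * indicator B (snd z) \<partial>\<mu>) = (\<integral>z. (1 + u z) * indicator B (snd z) \<partial>\<nu>)"
      proof (rule w)
        show "(CLINT z|\<mu>. complex_of_real (1 + u z) * iexp (r * snd z)) =
          (CLINT z|\<nu>. complex_of_real (1 + u z) * iexp (r * snd z))" for r
          unfolding dist using ue[of r] c0[of r]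
          by (subst (1 2) Bochner_Integration.integral_add) (simp_all del: of_real_mult)
      next
        show "0 \<le> 1 + u z" "1 + u z \<le> 2" for z using u2(2,3)[of z] by linarith+
      qed measurable
      then show ?thesis
        using w0 unfolding dist by (subst (asm) (1 2) Bochner_Integration.integral_add) simp_all
    qed
    have wc: "(\<integral>z. cos (t * fst z) * indicator B (snd z) \<partial>\<mu>) =
        (\<integral>z. cos (t * fst z) * indicator B (snd z) \<partial>\<nu>)" for t
      by (rule wu) (use cc in simp_all)
    have ws: "(\<integral>z. sin (t * fst z) * indicator B (snd z) \<partial>\<mu>) =
        (\<integral>z. sin (t * fst z) * indicator B (snd z) \<partial>\<nu>)" for t
      by (rule wu) (use cs in simp_all)
    have trig2: "\<bar>cos x\<bar> \<le> 2" "\<bar>sin x\<bar> \<le> 2" for x :: real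
      using abs_cos_le_one[of x] abs_sin_le_one[of x] by linarith+
    have iexp_eq: "complex_of_real (indicator B y) * iexp (t * x) =
      complex_of_real (cos (t * x) * indicator B y) + \<i> * complex_of_real (sin (t * x) * indicator B y)"
      for x y t
      by (simp add: complex_eq_iff Re_exp Im_exp)
    \<comment> \<open>The coordinates change roles: the second now enters only through the weight,
      and the transform in the first is assembled from \<open>wc\<close> and \<open>ws\<close> by
      Euler's formula.\<close>
    have "(\<integral>z. indicator B (snd z) * indicator A (fst z) \<partial>\<mu>) =
        (\<integral>z. indicator B (snd z) * indicator A (fst z) \<partial>\<nu> :: real)"
    proof (rule weighted_law_unique[where D=1, OF fin])
      fix t
      show "(CLINT z|\<mu>. complex_of_real (indicator B (snd z)) * iexp (t * fst z)) =
        (CLINT z|\<nu>. complex_of_real (indicator B (snd z)) * iexp (t * fst z))"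
        unfolding iexp_eq using wc[of t] ws[of t]
        by (subst (1 2) Bochner_Integration.integral_add)
          (auto simp: bi\<mu> bi\<nu> indicator_def norm_mult trig2 simp del: of_real_mult
            intro!: bi\<mu> bi\<nu>)
    qed (auto simp: indicator_def)
    moreover have "indicator B (snd z) * indicator A (fst z) = (indicator (A \<times> B) z :: real)" for z
      by (cases z) (auto simp: indicator_def)
    ultimately have "measure \<mu> (A \<times> B) = measure \<nu> (A \<times> B)" by simp
    then show ?thesis by (simp add: \<mu>.emeasure_eq_measure \<nu>.emeasure_eq_measure)
  qed
  show ?thesis
  proof (rule measure_eqI_generator_eq[OF Int_stable_pair_measure_generator[of borel borel]])
    show "sets \<mu> = sigma_sets UNIV {a \<times> b |a b. a \<in> sets (borel::real measure) \<and> b \<in> sets (borel::real measure)}"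
      "sets \<nu> = sigma_sets UNIV {a \<times> b |a b. a \<in> sets (borel::real measure) \<and> b \<in> sets (borel::real measure)}"
      using sets_pair_measure[of "borel::real measure" "borel::real measure"] by auto
    show "range (\<lambda>_::nat. UNIV) \<subseteq> {a \<times> b |a b. a \<in> sets (borel::real measure) \<and> b \<in> sets (borel::real measure)}"
      by (auto intro!: exI[of _ UNIV])
  qed (auto simp: rect)
qed

section \<open>Bivariate normal laws\<close>

abbreviation "\<G> \<equiv> std_normal_distribution"

interpretation std_normal: real_distribution \<G>
  by (rule real_dist_normal_dist)

lemma char_product_std_normal:
  "(CLINT z|\<G> \<Otimes>\<^sub>M \<G>. iexp (p * fst z + q * snd z)) = exp (- (p\<^sup>2 + q\<^sup>2) / 2)"
proof -
  interpret P: pair_prob_space \<G> \<G> ..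
  have char: "(CLINT z|\<G>. iexp (t * z)) = exp (- t\<^sup>2 / 2)" for t
    using fun_cong[OF char_std_normal_distribution, of t] by (simp add: char_def exp_of_real)
  have "(CLINT z|\<G> \<Otimes>\<^sub>M \<G>. iexp (p * fst z + q * snd z)) =
      (CLINT x|\<G>. CLINT y|\<G>. iexp (p * x + q * y))"
  proof (rule trans[OF P.integral_fst'[symmetric]])
    show "integrable (\<G> \<Otimes>\<^sub>M \<G>) (\<lambda>z. iexp (p * fst z + q * snd z))"
      by (rule P.P.integrable_const_bound[where B=1]) auto
  qed simp
  also have "\<dots> = (CLINT x|\<G>. iexp (p * x) * (CLINT y|\<G>. iexp (q * y)))"
    by (simp add: exp_add ring_distribs)
  also have "\<dots> = exp (- p\<^sup>2 / 2) * exp (- q\<^sup>2 / 2)"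
    by (simp only: char integral_mult_left_zero) simp
  also have "\<dots> = exp (- (p\<^sup>2 + q\<^sup>2) / 2)"
    by (simp add: exp_add[symmetric] add_divide_distrib)
  finally show ?thesis .
qed

text \<open>Stability of the centred normal law: the transform depends on \<open>p\<close> and
  \<open>q\<close> only through \<open>p\<^sup>2 + q\<^sup>2\<close>. No sign is imposed on
  \<open>s\<close>, so reflection symmetry is an instance as well.\<close>

lemma distr_product_std_normal:
  assumes "p\<^sup>2 + q\<^sup>2 = s\<^sup>2"
  shows "distr (\<G> \<Otimes>\<^sub>M \<G>) borel (\<lambda>z. p * fst z + q * snd z) = distr \<G> borel (\<lambda>z. s * z)"
proof (rule finite_char_unique)
  interpret P: pair_prob_space \<G> \<G> ..
  show "finite_measure (distr (\<G> \<Otimes>\<^sub>M \<G>) borel (\<lambda>z. p * fst z + q * snd z))"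
    by (rule P.P.finite_measure_distr) simp
  show "finite_measure (distr \<G> borel (\<lambda>z. s * z))"
    by (rule std_normal.finite_measure_distr) simp
  fix t
  have "char (distr (\<G> \<Otimes>\<^sub>M \<G>) borel (\<lambda>z. p * fst z + q * snd z)) t =
    (CLINT z|\<G> \<Otimes>\<^sub>M \<G>. iexp (t * p * fst z + t * q * snd z))"
    by (simp add: char_def integral_distr ring_distribs mult.assoc)
  also have "\<dots> = exp (- (t * s)\<^sup>2 / 2)"
    unfolding char_product_std_normal
    by (simp add: power_mult_distrib assms[symmetric] ring_distribs)
  also have "\<dots> = char (distr \<G> borel (\<lambda>z. s * z)) t"
    using fun_cong[OF char_std_normal_distribution, of "t * s"]
    by (simp add: char_def integral_distr mult.assoc exp_of_real)
  finally show "char (distr (\<G> \<Otimes>\<^sub>M \<G>) borel (\<lambda>z. p * fst z + q * snd z)) t = char (distr \<G> borel (\<lambda>z. s * z)) t" .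
qed auto

lemma sets_bivariate_std_normal [simp, measurable_cong]:
  "sets (bivariate_std_normal r) = sets (borel \<Otimes>\<^sub>M borel)"
  by (simp add: bivariate_std_normal_def)

lemma space_bivariate_std_normal [simp]: "space (bivariate_std_normal r) = UNIV"
  by (simp add: bivariate_std_normal_def space_pair_measure)

lemma prob_space_bivariate_std_normal: "prob_space (bivariate_std_normal r)"
proof -
  interpret P: pair_prob_space \<G> \<G> ..
  show ?thesis unfolding bivariate_std_normal_def by (rule P.P.prob_space_distr) simp
qed

lemma char_bivariate_std_normal:
  assumes "\<bar>r\<bar> \<le> 1"
  shows "(CLINT z|bivariate_std_normal r. iexp (a * fst z + b * snd z)) =
    exp (- (a\<^sup>2 + 2 * a * b * r + b\<^sup>2) / 2)"
proof -
  \<comment> \<open>Here \<open>\<bar>r\<bar> \<le> 1\<close> matters: for any real argument the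
    square of \<open>sqrt\<close> is the absolute value of that argument.\<close>
  have r: "(sqrt (1 - r\<^sup>2))\<^sup>2 = 1 - r\<^sup>2" using assms by (simp add: abs_square_le_1)
  have "(CLINT z|bivariate_std_normal r. iexp (a * fst z + b * snd z)) =
     (CLINT z|\<G> \<Otimes>\<^sub>M \<G>. iexp ((a + b * r) * fst z + (b * sqrt (1 - r\<^sup>2)) * snd z))"
    unfolding bivariate_std_normal_def
    by (simp add: integral_distr case_prod_beta ring_distribs mult.assoc add.assoc)
  moreover have "(a + b * r)\<^sup>2 + (b * sqrt (1 - r\<^sup>2))\<^sup>2 = a\<^sup>2 + 2 * a * b * r + b\<^sup>2"
    by (simp add: power_mult_distrib r) (simp add: power2_eq_square algebra_simps)
  ultimately show ?thesis
    by (simp only: char_product_std_normal)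
qed

text \<open>Identification by transforms instead of densities treats the degenerate correlations
  \<open>1\<close> and \<open>-1\<close> like all others.\<close>

lemma bivariate_std_normalI:
  assumes "prob_space M" "\<bar>r\<bar> \<le> 1"
    and [measurable]: "X \<in> borel_measurable M" "Y \<in> borel_measurable M"
    and eq: "\<And>a b. (CLINT z|M. iexp (a * X z + b * Y z)) = exp (- (a\<^sup>2 + 2 * a * b * r + b\<^sup>2) / 2)"
  shows "distr M (borel \<Otimes>\<^sub>M borel) (\<lambda>z. (X z, Y z)) = bivariate_std_normal r"
proof (rule char2_unique)
  interpret prob_space M by fact
  show "finite_measure (distr M (borel \<Otimes>\<^sub>M borel) (\<lambda>z. (X z, Y z)))"
    by (rule finite_measure_distr) simp
  show "finite_measure (bivariate_std_normal r)"
    using prob_space_bivariate_std_normal by (rule prob_space.finite_measure)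
  show "(CLINT z|distr M (borel \<Otimes>\<^sub>M borel) (\<lambda>z. (X z, Y z)). iexp (a * fst z + b * snd z)) =
    (CLINT z|bivariate_std_normal r. iexp (a * fst z + b * snd z))" for a b
    unfolding char_bivariate_std_normal[OF assms(2)] eq[symmetric] by (simp add: integral_distr)
qed auto

text \<open>As an affine image of the standard normal law, point masses need no separate treatment
  later, and moments and transforms can be computed under \<open>\<G>\<close>.\<close>

lemma normal_law_eq_distr:
  assumes "\<sigma> \<ge> 0"
  shows "normal_law m \<sigma> = distr \<G> borel (\<lambda>z. m + \<sigma> * z)"
proof (cases "\<sigma> = 0")
  case True
  then show ?thesis by (simp add: normal_law_def std_normal.prob_space)
next
  case False
  have "distributed \<G> lborel (\<lambda>z. z) (normal_density 0 1)"
    by (auto simp: distributed_def distr_id2)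
  from std_normal.normal_density_affine[OF this, of \<sigma> m] False assms
  have "distr \<G> lborel (\<lambda>z. m + \<sigma> * z) = density lborel (normal_density m \<sigma>)"
    by (simp add: distributed_def)
  also have "distr \<G> lborel (\<lambda>z. m + \<sigma> * z) = distr \<G> borel (\<lambda>z. m + \<sigma> * z)"
    by (rule distr_cong) auto
  finally show ?thesis using False by (simp add: normal_law_def)
qed

lemma std_normal_moments:
  "integrable \<G> (\<lambda>z. z)" "(\<integral>z. z \<partial>\<G>) = 0" "integrable \<G> (\<lambda>z. z\<^sup>2)" "(\<integral>z. z\<^sup>2 \<partial>\<G>) = 1"
  using integrable_std_normal_moment[of 1] integral_std_normal_moment_odd[of 0]
    integrable_std_normal_moment[of 2] integral_std_normal_moment_even[of 1]
  by (simp_all add: integrable_density integral_density)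

text \<open>The argument is that of Cramer and Wold: each combination \<open>a * X + b * Y\<close>
  is normal, its first two moments fix its parameters, and its transform at \<open>1\<close> is the
  transform of the pair at \<open>(a, b)\<close>. As the marginals are standard, the mixed moment
  \<open>r\<close> is also the correlation.\<close>

lemma (in prob_space) joint_law_std_normal:
  assumes [measurable]: "X \<in> borel_measurable M" "Y \<in> borel_measurable M"
    and X: "distr M borel X = \<G>" and Y: "distr M borel Y = \<G>"
    and lin: "\<And>a b. \<exists>m \<sigma>. \<sigma> \<ge> 0 \<and> distr M borel (\<lambda>z. a * X z + b * Y z) = normal_law m \<sigma>"
  defines "r \<equiv> expectation (\<lambda>z. X z * Y z)"
  shows "\<bar>r\<bar> \<le> 1" "distr M (borel \<Otimes>\<^sub>M borel) (\<lambda>z. (X z, Y z)) = bivariate_std_normal r"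
    "correlation M X Y = r"
proof -
  have mom: "integrable M Z" "expectation Z = 0" "integrable M (\<lambda>z. (Z z)\<^sup>2)" "expectation (\<lambda>z. (Z z)\<^sup>2) = 1"
    if [measurable]: "Z \<in> borel_measurable M" and Z: "distr M borel Z = \<G>" for Z
    using std_normal_moments unfolding Z[symmetric]
    by (simp_all add: integrable_distr_eq integral_distr)
  note mX = mom[OF assms(1) X] and mY = mom[OF assms(2) Y]
  have XY: "integrable M (\<lambda>z. X z * Y z)"
  proof (rule Bochner_Integration.integrable_bound)
    show "integrable M (\<lambda>z. (X z)\<^sup>2 + (Y z)\<^sup>2)" using mX mY by simp
    have "\<bar>x * y\<bar> \<le> \<bar>x\<^sup>2 + y\<^sup>2\<bar>" for x y :: real
    proof -
      have "2 * \<bar>x\<bar> * \<bar>y\<bar> \<le> x\<^sup>2 + y\<^sup>2" "0 \<le> \<bar>x\<bar> * \<bar>y\<bar>"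
        using sum_squares_bound[of "\<bar>x\<bar>" "\<bar>y\<bar>"] by simp_all
      then show ?thesis unfolding abs_mult by linarith
    qed
    then show "AE z in M. norm (X z * Y z) \<le> norm ((X z)\<^sup>2 + (Y z)\<^sup>2)" by simp
  qed simp
  have sq: "(a * X z + b * Y z)\<^sup>2 = a\<^sup>2 * (X z)\<^sup>2 + (2 * a * b) * (X z * Y z) + b\<^sup>2 * (Y z)\<^sup>2" for a b z
    by (simp add: power2_eq_square algebra_simps)
  have E2: "expectation (\<lambda>z. (a * X z + b * Y z)\<^sup>2) = a\<^sup>2 + 2 * a * b * r + b\<^sup>2" for a b
    unfolding sq using mX mY XY by (simp add: r_def)
  \<comment> \<open>The choices \<open>b = 1\<close> and \<open>b = -1\<close> give
    \<open>0 \<le> 2 + 2 * r\<close> and \<open>0 \<le> 2 - 2 * r\<close>.\<close>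
  have "0 \<le> expectation (\<lambda>z. (1 * X z + b * Y z)\<^sup>2)" for b
    by (intro integral_nonneg_AE) auto
  from this[of 1] this[of "-1"] show r1: "\<bar>r\<bar> \<le> 1" unfolding E2 by simp
  show "distr M (borel \<Otimes>\<^sub>M borel) (\<lambda>z. (X z, Y z)) = bivariate_std_normal r"
  proof (rule bivariate_std_normalI[OF prob_space_axioms r1])
    fix a b
    obtain m \<sigma> where \<sigma>: "\<sigma> \<ge> 0" and d: "distr M borel (\<lambda>z. a * X z + b * Y z) = distr \<G> borel (\<lambda>z. m + \<sigma> * z)"
      using lin[of a b] normal_law_eq_distr by metis
    \<comment> \<open>Used three times: the identity gives \<open>m = 0\<close>, the square gives
      the value of \<open>\<sigma>\<^sup>2\<close>, and \<open>iexp\<close> gives the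
      transform.\<close>
    have tr: "(\<integral>z. f (a * X z + b * Y z) \<partial>M) = (\<integral>z. f (m + \<sigma> * z) \<partial>\<G>)"
      if [measurable]: "f \<in> borel_measurable borel"
      for f :: "real \<Rightarrow> 'c::{banach,second_countable_topology}"
    proof -
      have "(\<integral>z. f (a * X z + b * Y z) \<partial>M) = (\<integral>z. f z \<partial>distr M borel (\<lambda>z. a * X z + b * Y z))"
        by (simp add: integral_distr)
      also have "\<dots> = (\<integral>z. f (m + \<sigma> * z) \<partial>\<G>)"
        unfolding d by (simp add: integral_distr)
      finally show ?thesis .
    qed
    have G1: "(\<integral>z. m + \<sigma> * z \<partial>\<G>) = m"
      by (subst Bochner_Integration.integral_add) (simp_all add: std_normal_moments std_normal.prob_space[simplified])
    have "(\<integral>z. a * X z + b * Y z \<partial>M) = 0"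
      using mX mY by (subst Bochner_Integration.integral_add) simp_all
    then have "m = 0"
      using tr[OF measurable_ident_sets[OF refl]] G1 by metis
    have "(\<integral>z. (0 + \<sigma> * z)\<^sup>2 \<partial>\<G>) = \<sigma>\<^sup>2"
      by (simp add: power_mult_distrib std_normal_moments)
    then have "\<sigma>\<^sup>2 = a\<^sup>2 + 2 * a * b * r + b\<^sup>2"
      using tr[of "\<lambda>z. z\<^sup>2"] \<open>m = 0\<close> E2[of a b] by simp
    moreover have "(CLINT z|M. iexp (a * X z + b * Y z)) = exp (- \<sigma>\<^sup>2 / 2)"
      using tr[of iexp] \<open>m = 0\<close> fun_cong[OF char_std_normal_distribution, of "\<sigma>"]
      by (simp add: char_def exp_of_real)
    ultimately show "(CLINT z|M. iexp (a * X z + b * Y z)) = exp (- (a\<^sup>2 + 2 * a * b * r + b\<^sup>2) / 2)"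
      by simp
  qed simp_all
  show "correlation M X Y = r"
    using mX mY by (simp add: correlation_def covariance_def r_def power2_eq_square)
qed

section \<open>The probability of a joint two-sided rejection\<close>

definition joint_tail :: "real \<Rightarrow> real \<Rightarrow> real" where
  "joint_tail c r = measure (bivariate_std_normal r) ({x. \<bar>x\<bar> > c} \<times> {y. \<bar>y\<bar> > c})"

lemma marginals_bivariate_std_normal:
  assumes "\<bar>r\<bar> \<le> 1"
  shows "distr (bivariate_std_normal r) borel fst = \<G>" "distr (bivariate_std_normal r) borel snd = \<G>"
proof -
  interpret prob_space "bivariate_std_normal r" by (rule prob_space_bivariate_std_normal)
  have char: "char \<G> t = exp (- t\<^sup>2 / 2)" for t
    by (simp add: char_std_normal_distribution)
  show "distr (bivariate_std_normal r) borel fst = \<G>"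
  proof (rule finite_char_unique)
    show "char (distr (bivariate_std_normal r) borel fst) t = char \<G> t" for t
      using char_bivariate_std_normal[OF assms, of t 0]
      unfolding char by (simp add: char_def integral_distr)
  qed (auto intro!: finite_measure_distr std_normal.finite_measure_axioms)
  show "distr (bivariate_std_normal r) borel snd = \<G>"
  proof (rule finite_char_unique)
    show "char (distr (bivariate_std_normal r) borel snd) t = char \<G> t" for t
      using char_bivariate_std_normal[OF assms, of 0 t]
      unfolding char by (simp add: char_def integral_distr)
  qed (auto intro!: finite_measure_distr std_normal.finite_measure_axioms)
qed

text \<open>The signs can be absorbed into the arguments of the transform. All four sign patterns of
  a pair thus reduce to the correlations \<open>r\<close> and \<open>- r\<close>.\<close>

lemma bivariate_std_normal_sign:
  assumes "\<bar>r\<bar> \<le> 1" "\<bar>s\<bar> = 1" "\<bar>t\<bar> = 1"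
  shows "distr (bivariate_std_normal r) (borel \<Otimes>\<^sub>M borel) (\<lambda>z. (s * fst z, t * snd z)) =
    bivariate_std_normal (s * t * r)"
proof (rule bivariate_std_normalI)
  show "\<bar>s * t * r\<bar> \<le> 1" using assms by (simp add: abs_mult)
  have st: "s\<^sup>2 = 1" "t\<^sup>2 = 1" using assms by (simp_all add: abs_square_eq_1)
  show "(CLINT z|bivariate_std_normal r. iexp (a * (s * fst z) + b * (t * snd z))) =
    exp (- (a\<^sup>2 + 2 * a * b * (s * t * r) + b\<^sup>2) / 2)" for a b
    using char_bivariate_std_normal[OF assms(1), of "a * s" "b * t"]
    by (simp add: power_mult_distrib st algebra_simps)
qed (auto intro: prob_space_bivariate_std_normal)

text \<open>Flipping the sign of the second coordinate negates the correlation and preserves the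
  two-sided event.\<close>

lemma joint_tail_uminus:
  assumes "\<bar>r\<bar> \<le> 1"
  shows "joint_tail c (- r) = joint_tail c r"
proof -
  have "joint_tail c (- r) = measure (distr (bivariate_std_normal r) (borel \<Otimes>\<^sub>M borel)
      (\<lambda>z. (1 * fst z, (-1) * snd z))) ({x. \<bar>x\<bar> > c} \<times> {y. \<bar>y\<bar> > c})"
    using bivariate_std_normal_sign[OF assms, of 1 "-1"] by (simp add: joint_tail_def)
  also have "\<dots> = joint_tail c r"
    unfolding joint_tail_def
    by (subst measure_distr) (auto intro!: arg_cong2[where f=measure])
  finally show ?thesis .
qed

text \<open>Each two-sided tail indicator is a combination of indicators of \<open>{..c}\<close> at
  a coordinate and at its negative. Expanding the product leaves only values of the two distribution
  functions, and the constant left over beside \<open>R_bound\<close> is the joint rejection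
  probability under independence.\<close>

lemma joint_tail_eq_R_bound:
  assumes r: "\<bar>r\<bar> \<le> 1" and c: "0 \<le> c"
  shows "joint_tail c r = R_bound r c + (2 * (1 - std_normal_cdf c))\<^sup>2"
proof -
  interpret prob_space "bivariate_std_normal r" by (rule prob_space_bivariate_std_normal)
  define I where "I = (\<lambda>x::real. indicator {..c} x :: real)"
  have [measurable]: "I \<in> borel_measurable borel" unfolding I_def by simp
  have I1: "\<bar>I x\<bar> \<le> 1" for x by (simp add: I_def indicator_def)
  have int1: "integrable (bivariate_std_normal r) (\<lambda>z. I (f z))"
    if [measurable]: "f \<in> borel_measurable (borel \<Otimes>\<^sub>M borel)" for f
    using I1 by (auto intro!: integrable_const_bound[where B=1])
  have int2: "integrable (bivariate_std_normal r) (\<lambda>z. I (f z) * I (g z))"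
    if [measurable]: "f \<in> borel_measurable (borel \<Otimes>\<^sub>M borel)" "g \<in> borel_measurable (borel \<Otimes>\<^sub>M borel)" for f g
    using mult_le_one[OF I1 _ I1] by (auto intro!: integrable_const_bound[where B=1] simp: abs_mult)
  have [simp]: "integrable (bivariate_std_normal r) (\<lambda>z. I (fst z))" "integrable (bivariate_std_normal r) (\<lambda>z. I (- fst z))"
    "integrable (bivariate_std_normal r) (\<lambda>z. I (snd z))" "integrable (bivariate_std_normal r) (\<lambda>z. I (- snd z))"
    "integrable (bivariate_std_normal r) (\<lambda>z. I (fst z) * I (snd z))" "integrable (bivariate_std_normal r) (\<lambda>z. I (fst z) * I (- snd z))"
    "integrable (bivariate_std_normal r) (\<lambda>z. I (- fst z) * I (snd z))" "integrable (bivariate_std_normal r) (\<lambda>z. I (- fst z) * I (- snd z))"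
    by (rule int1 int2; measurable)+
  have marg: "expectation (\<lambda>z. I (s * fst z)) = std_normal_cdf c \<and> expectation (\<lambda>z. I (s * snd z)) = std_normal_cdf c"
    if "\<bar>s\<bar> = 1" for s
  proof -
    have "(\<integral>x. I x \<partial>\<G>) = std_normal_cdf c" by (simp add: I_def std_normal_cdf_def cdf_def)
    moreover have "expectation (\<lambda>z. I (s * fst z)) = (\<integral>x. I x \<partial>\<G>)"
      by (subst marginals_bivariate_std_normal(1)[of "s * s * r", symmetric])
         (use that r in \<open>simp_all add: bivariate_std_normal_sign[symmetric] integral_distr abs_mult\<close>)
    moreover have "expectation (\<lambda>z. I (s * snd z)) = (\<integral>x. I x \<partial>\<G>)"
      by (subst marginals_bivariate_std_normal(2)[of "s * s * r", symmetric])
         (use that r in \<open>simp_all add: bivariate_std_normal_sign[symmetric] integral_distr abs_mult\<close>)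
    ultimately show ?thesis by simp
  qed
  have joint: "expectation (\<lambda>z. I (s * fst z) * I (t * snd z)) = bivariate_std_normal_cdf (s * t * r) c c"
    if "\<bar>s\<bar> = 1" "\<bar>t\<bar> = 1" for s t
  proof -
    have II: "indicator ({..c} \<times> {..c}) z = I (fst z) * I (snd z)" for z
      by (cases z) (auto simp: I_def indicator_def)
    have "bivariate_std_normal_cdf (s * t * r) c c =
        (\<integral>z. indicator ({..c} \<times> {..c}) z \<partial>bivariate_std_normal (s * t * r))"
      by (simp add: bivariate_std_normal_cdf_def)
    also have "\<dots> = expectation (\<lambda>z. I (s * fst z) * I (t * snd z))"
      unfolding II bivariate_std_normal_sign[OF r that, symmetric] by (simp add: integral_distr)
    finally show ?thesis by simp
  qed
  \<comment> \<open>For \<open>0 \<le> c\<close> the events \<open>x > c\<close> and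
    \<open>- x > c\<close> exclude each other, so their indicators \<open>1 - I x\<close> and
    \<open>1 - I (- x)\<close> add up to that of the union.\<close>
  have ind: "indicator {x. \<bar>x\<bar> > c} x = 2 - I x - I (- x)" for x
    using c by (auto simp: I_def indicator_def)
  have "joint_tail c r = expectation (\<lambda>z. indicator ({x. \<bar>x\<bar> > c} \<times> {y. \<bar>y\<bar> > c}) z)"
    by (simp add: joint_tail_def)
  also have "\<dots> = expectation (\<lambda>z. (2 - I (fst z) - I (- fst z)) * (2 - I (snd z) - I (- snd z)))"
    by (intro Bochner_Integration.integral_cong refl) (auto simp: ind[symmetric] indicator_def)
  also have "\<dots> = expectation (\<lambda>z. 4 - 2 * I (fst z) - 2 * I (- fst z) - 2 * I (snd z) - 2 * I (- snd z)
     + I (fst z) * I (snd z) + I (fst z) * I (- snd z) + I (- fst z) * I (snd z) + I (- fst z) * I (- snd z))"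
    by (intro Bochner_Integration.integral_cong refl) (simp add: algebra_simps)
  \<comment> \<open>Equal signs give correlation \<open>r\<close> and opposite signs
    \<open>- r\<close>, so each bivariate value occurs twice.\<close>
  also have "\<dots> = 4 - 8 * std_normal_cdf c + 2 * bivariate_std_normal_cdf r c c
      + 2 * bivariate_std_normal_cdf (- r) c c"
    using marg[of 1] marg[of "-1"] joint[of 1 1] joint[of 1 "-1"] joint[of "-1" 1] joint[of "-1" "-1"]
      prob_space by simp
  also have "\<dots> = R_bound r c + (2 * (1 - std_normal_cdf c))\<^sup>2"
    by (simp add: R_bound_def power2_eq_square algebra_simps)
  finally show ?thesis .
qed

text \<open>For \<open>r \<ge> 0\<close> a pair with correlation \<open>r\<close> arises from a common part \<open>sqrt r * z\<close> by adding two
  conditionally independent parts of variance \<open>1 - r\<close>; this is the rejection probability given \<open>z\<close>.\<close>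

definition cond_tail :: "real \<Rightarrow> real \<Rightarrow> real \<Rightarrow> real" where
  "cond_tail c r z = (\<integral>w. indicator {x. \<bar>x\<bar> > c} (sqrt r * z + sqrt (1 - r) * w) \<partial>\<G>)"

lemma cond_tail_measurable [measurable]: "cond_tail c r \<in> borel_measurable borel"
  unfolding cond_tail_def by measurable

lemma cond_tail_nonneg: "0 \<le> cond_tail c r z"
  by (simp add: cond_tail_def integral_nonneg_AE)

lemma cond_tail_le_1: "cond_tail c r z \<le> 1"
proof -
  have "cond_tail c r z \<le> (\<integral>w. 1 \<partial>\<G>)"
    unfolding cond_tail_def
    by (intro integral_mono std_normal.integrable_const_bound[where B=1]) (auto simp: indicator_def)
  then show ?thesis using std_normal.prob_space by simp
qed

lemma integral_std_normal_combination:
  fixes f :: "real \<Rightarrow> real"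
  assumes [measurable]: "f \<in> borel_measurable borel" and bnd: "\<And>x. \<bar>f x\<bar> \<le> 1"
    and s: "p\<^sup>2 + q\<^sup>2 = s\<^sup>2"
  shows "(\<integral>x. \<integral>y. f (p * x + q * y) \<partial>\<G> \<partial>\<G>) = (\<integral>x. f (s * x) \<partial>\<G>)"
proof -
  interpret P: pair_prob_space \<G> \<G> ..
  have "(\<integral>x. f (s * x) \<partial>\<G>) = (\<integral>x. f x \<partial>distr \<G> borel (\<lambda>x. s * x))"
    by (simp add: integral_distr)
  also have "\<dots> = (\<integral>z. f (p * fst z + q * snd z) \<partial>(\<G> \<Otimes>\<^sub>M \<G>))"
    unfolding distr_product_std_normal[OF s, symmetric] by (simp add: integral_distr)
  also have "\<dots> = (\<integral>x. \<integral>y. f (p * x + q * y) \<partial>\<G> \<partial>\<G>)"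
  proof (rule trans[OF P.integral_fst'[symmetric]])
    show "integrable (\<G> \<Otimes>\<^sub>M \<G>) (\<lambda>z. f (p * fst z + q * snd z))"
      by (rule P.P.integrable_const_bound[where B=1]) (use bnd in auto)
  qed simp
  finally show ?thesis by simp
qed

text \<open>Given the common part, the two rejections are independent and equally likely, so the
  conditional probability of both is a square. This is what opens the way to a convexity argument in
  \<open>r\<close>.\<close>

lemma joint_tail_eq_integral:
  assumes r: "0 \<le> r" "r \<le> 1"
  shows "joint_tail c r = (\<integral>z. (cond_tail c r z)\<^sup>2 \<partial>\<G>)"
proof -
  interpret P: pair_prob_space \<G> \<G> ..
  interpret Q: pair_prob_space \<G> "\<G> \<Otimes>\<^sub>M \<G>" ..
  define X Y where "X = (\<lambda>z::real\<times>real\<times>real. sqrt r * fst z + sqrt (1 - r) * fst (snd z))"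
    and "Y = (\<lambda>z::real\<times>real\<times>real. sqrt r * fst z + sqrt (1 - r) * snd (snd z))"
  have [measurable]: "X \<in> borel_measurable (\<G> \<Otimes>\<^sub>M (\<G> \<Otimes>\<^sub>M \<G>))" "Y \<in> borel_measurable (\<G> \<Otimes>\<^sub>M (\<G> \<Otimes>\<^sub>M \<G>))"
    unfolding X_def Y_def by measurable
  have law: "distr (\<G> \<Otimes>\<^sub>M (\<G> \<Otimes>\<^sub>M \<G>)) (borel \<Otimes>\<^sub>M borel) (\<lambda>z. (X z, Y z)) = bivariate_std_normal r"
  proof (rule bivariate_std_normalI)
    fix a b
    have char: "(CLINT z|\<G>. iexp (t * z)) = exp (- t\<^sup>2 / 2)" for t
      using fun_cong[OF char_std_normal_distribution, of t] by (simp add: char_def exp_of_real)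
    have split: "iexp (a * (sqrt r * x + sqrt (1 - r) * u) + b * (sqrt r * x + sqrt (1 - r) * v)) =
        iexp (((a + b) * sqrt r) * x) * iexp ((a * sqrt (1 - r)) * u + (b * sqrt (1 - r)) * v)" for x u v
      by (simp add: exp_add[symmetric] algebra_simps)
    have "(CLINT z|\<G> \<Otimes>\<^sub>M (\<G> \<Otimes>\<^sub>M \<G>). iexp (a * X z + b * Y z)) =
      (CLINT x|\<G>. CLINT w|\<G> \<Otimes>\<^sub>M \<G>. iexp (a * (sqrt r * x + sqrt (1 - r) * fst w) + b * (sqrt r * x + sqrt (1 - r) * snd w)))"
    proof (rule trans[OF Q.integral_fst'[symmetric]])
      show "integrable (\<G> \<Otimes>\<^sub>M (\<G> \<Otimes>\<^sub>M \<G>)) (\<lambda>z. iexp (a * X z + b * Y z))"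
        by (rule Q.P.integrable_const_bound[where B=1]) auto
    qed (simp add: X_def Y_def)
    also have "\<dots> = exp (- ((a + b) * sqrt r)\<^sup>2 / 2) * exp (- ((a * sqrt (1 - r))\<^sup>2 + (b * sqrt (1 - r))\<^sup>2) / 2)"
      unfolding split by (simp only: char char_product_std_normal integral_mult_left_zero integral_mult_right_zero) simp
    \<comment> \<open>The common part contributes variance \<open>(a + b)\<^sup>2 * r\<close> and
      the separate parts \<open>(a\<^sup>2 + b\<^sup>2) * (1 - r)\<close>.\<close>
    also have "\<dots> = exp (- (a\<^sup>2 + 2 * a * b * r + b\<^sup>2) / 2)"
      using r by (simp add: exp_add[symmetric] power_mult_distrib)
         (simp add: power2_eq_square field_simps)
    finally show "(CLINT z|\<G> \<Otimes>\<^sub>M (\<G> \<Otimes>\<^sub>M \<G>). iexp (a * X z + b * Y z)) = exp (- (a\<^sup>2 + 2 * a * b * r + b\<^sup>2) / 2)" .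
  qed (use r Q.P.prob_space_axioms in auto)
  define h where "h = (\<lambda>x::real. indicator {x. \<bar>x\<bar> > c} x :: real)"
  have [measurable]: "h \<in> borel_measurable borel" unfolding h_def by measurable
  have h1: "\<bar>h x\<bar> \<le> 1" "\<bar>h x * h y\<bar> \<le> 1" for x y by (simp_all add: h_def indicator_def)
  have "joint_tail c r = (\<integral>z. h (fst z) * h (snd z) \<partial>bivariate_std_normal r)"
  proof -
    have "h (fst z) * h (snd z) = indicator ({x. \<bar>x\<bar> > c} \<times> {y. \<bar>y\<bar> > c}) z" for z
      by (cases z) (auto simp: h_def indicator_def)
    then show ?thesis by (simp add: joint_tail_def)
  qed
  also have "\<dots> = (\<integral>z. h (X z) * h (Y z) \<partial>(\<G> \<Otimes>\<^sub>M (\<G> \<Otimes>\<^sub>M \<G>)))"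
    unfolding law[symmetric] by (simp add: integral_distr)
  also have "\<dots> = (\<integral>x. \<integral>w. h (sqrt r * x + sqrt (1 - r) * fst w) * h (sqrt r * x + sqrt (1 - r) * snd w) \<partial>(\<G> \<Otimes>\<^sub>M \<G>) \<partial>\<G>)"
  proof (rule trans[OF Q.integral_fst'[symmetric]])
    show "integrable (\<G> \<Otimes>\<^sub>M (\<G> \<Otimes>\<^sub>M \<G>)) (\<lambda>z. h (X z) * h (Y z))"
      by (rule Q.P.integrable_const_bound[where B=1]) (use h1 in auto)
  qed (simp add: X_def Y_def)
  also have "\<dots> = (\<integral>x. (cond_tail c r x)\<^sup>2 \<partial>\<G>)"
  proof (rule Bochner_Integration.integral_cong[OF refl])
    fix x
    have "(\<integral>w. h (sqrt r * x + sqrt (1 - r) * fst w) * h (sqrt r * x + sqrt (1 - r) * snd w) \<partial>(\<G> \<Otimes>\<^sub>M \<G>)) =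
      (\<integral>u. \<integral>v. h (sqrt r * x + sqrt (1 - r) * u) * h (sqrt r * x + sqrt (1 - r) * v) \<partial>\<G> \<partial>\<G>)"
    proof (rule trans[OF P.integral_fst'[symmetric]])
      show "integrable (\<G> \<Otimes>\<^sub>M \<G>) (\<lambda>w. h (sqrt r * x + sqrt (1 - r) * fst w) * h (sqrt r * x + sqrt (1 - r) * snd w))"
        by (rule P.P.integrable_const_bound[where B=1]) (use h1 in auto)
    qed simp
    also have "\<dots> = (cond_tail c r x)\<^sup>2"
      by (simp only: integral_mult_left_zero integral_mult_right_zero cond_tail_def h_def power2_eq_square)
    finally show "(\<integral>w. h (sqrt r * x + sqrt (1 - r) * fst w) * h (sqrt r * x + sqrt (1 - r) * snd w) \<partial>(\<G> \<Otimes>\<^sub>M \<G>)) =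
      (cond_tail c r x)\<^sup>2" .
  qed
  finally show ?thesis .
qed

text \<open>The common part at correlation \<open>r'\<close> refines the one at \<open>r \<le> r'\<close>, so that \<open>cond_tail c r\<close> is
  an average of \<open>cond_tail c r'\<close> and its second moment is the smaller one by Jensen's inequality.\<close>

lemma joint_tail_mono:
  assumes r: "0 \<le> r" "r \<le> r'" "r' \<le> 1"
  shows "joint_tail c r \<le> joint_tail c r'"
proof (cases "r' = 0")
  case True
  then show ?thesis using r by simp
next
  case False
  then have r': "0 < r'" using r by simp
  \<comment> \<open>The choice makes \<open>p\<^sup>2 + q\<^sup>2 = 1\<close> and
    \<open>sqrt r' * p = sqrt r\<close>, so the common part at \<open>r'\<close> is the one at
    \<open>r\<close> plus independent noise. The division by \<open>r'\<close> is the reason for the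
    case split.\<close>
  define p q where "p = sqrt (r / r')" and "q = sqrt (1 - r / r')"
  have le1: "r / r' \<le> 1" using r r' by simp
  have pq: "p\<^sup>2 = r / r'" "q\<^sup>2 = 1 - r / r'" using r r' le1 by (simp_all add: p_def q_def)
  have sp: "sqrt r' * p = sqrt r" using r' by (simp add: p_def real_sqrt_divide)
  have cond: "cond_tail c r x = (\<integral>u. cond_tail c r' (p * x + q * u) \<partial>\<G>)" for x
  proof -
    \<comment> \<open>The common part \<open>sqrt r * x\<close> becomes a fixed shift. The two
      remaining independent parts have variances \<open>r' - r\<close> and \<open>1 - r'\<close>,
      which add up to \<open>1 - r\<close>.\<close>
    let ?f = "\<lambda>y. indicator {x. \<bar>x\<bar> > c} (sqrt r * x + y) :: real"
    have "(\<integral>u. cond_tail c r' (p * x + q * u) \<partial>\<G>) =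
      (\<integral>u. \<integral>w. ?f ((sqrt r' * q) * u + sqrt (1 - r') * w) \<partial>\<G> \<partial>\<G>)"
      unfolding cond_tail_def sp[symmetric] by (simp add: algebra_simps)
    also have "\<dots> = (\<integral>w. ?f (sqrt (1 - r) * w) \<partial>\<G>)"
    proof (rule integral_std_normal_combination)
      show "(sqrt r' * q)\<^sup>2 + (sqrt (1 - r'))\<^sup>2 = (sqrt (1 - r))\<^sup>2"
        using r r' by (simp add: power_mult_distrib pq field_simps)
    qed (auto simp: indicator_def)
    finally show ?thesis by (simp add: cond_tail_def)
  qed
  have int: "integrable \<G> (\<lambda>u. cond_tail c r'' (a + b * u))" "integrable \<G> (\<lambda>u. (cond_tail c r'' (a + b * u))\<^sup>2)"
    for a b r''
    using cond_tail_nonneg cond_tail_le_1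
    by (auto intro!: std_normal.integrable_const_bound[where B=1] simp: power_le_one)
  \<comment> \<open>Jensen's inequality for the square, in the form that a variance is
    nonnegative.\<close>
  have jensen: "(cond_tail c r x)\<^sup>2 \<le> (\<integral>u. (cond_tail c r' (p * x + q * u))\<^sup>2 \<partial>\<G>)" for x
    using std_normal.variance_positive[of "\<lambda>u. cond_tail c r' (p * x + q * u)"]
    by (subst (asm) std_normal.variance_eq) (simp_all add: int cond)
  have bnd: "\<bar>(cond_tail c r' y)\<^sup>2\<bar> \<le> 1" for y
    using cond_tail_nonneg cond_tail_le_1 by (simp add: power_le_one)
  have "joint_tail c r = (\<integral>x. (cond_tail c r x)\<^sup>2 \<partial>\<G>)"
    using r by (intro joint_tail_eq_integral) auto
  also have "\<dots> \<le> (\<integral>x. \<integral>u. (cond_tail c r' (p * x + q * u))\<^sup>2 \<partial>\<G> \<partial>\<G>)"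
  proof (rule integral_mono)
    show "integrable \<G> (\<lambda>x. (cond_tail c r x)\<^sup>2)"
      using int(2)[of r 0 1] by simp
    show "integrable \<G> (\<lambda>x. \<integral>u. (cond_tail c r' (p * x + q * u))\<^sup>2 \<partial>\<G>)"
    proof (rule std_normal.integrable_const_bound[where B=1])
      have "(\<integral>u. (cond_tail c r' (p * x + q * u))\<^sup>2 \<partial>\<G>) \<le> (\<integral>u. 1 \<partial>\<G>)" for x
        using bnd by (intro integral_mono int) auto
      then show "AE x in \<G>. norm (\<integral>u. (cond_tail c r' (p * x + q * u))\<^sup>2 \<partial>\<G>) \<le> 1"
        using std_normal.prob_space by (simp add: integral_nonneg_AE)
    qed measurable
  qed (rule jensen)
  \<comment> \<open>For independent standard normal \<open>x\<close> and \<open>u\<close>,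
    \<open>p * x + q * u\<close> is again standard normal.\<close>
  also have "\<dots> = (\<integral>z. (cond_tail c r' (1 * z))\<^sup>2 \<partial>\<G>)"
    by (rule integral_std_normal_combination) (use bnd in \<open>auto simp: pq\<close>)
  also have "\<dots> = joint_tail c r'"
    using r r' by (simp add: joint_tail_eq_integral)
  finally show ?thesis .
qed

lemma joint_tail_mono_abs:
  assumes "\<bar>r\<bar> \<le> r'" "r' \<le> 1"
  shows "joint_tail c r \<le> joint_tail c r'"
proof -
  have "joint_tail c r = joint_tail c \<bar>r\<bar>"
    using assms joint_tail_uminus[of r c] by (cases "r \<ge> 0") auto
  then show ?thesis using joint_tail_mono[of "\<bar>r\<bar>" r' c] assms by simp
qed

section \<open>Normal tails and the bound on the probability of joint rejection\<close>

lemma std_normal_reflect: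
  assumes [measurable]: "A \<in> sets borel"
  shows "measure \<G> {x. - x \<in> A} = measure \<G> A"
proof -
  have "(\<integral>x. \<integral>y. indicator A (- 1 * x + 0 * y) \<partial>\<G> \<partial>\<G>) = (\<integral>x. indicator A (1 * x) \<partial>\<G> :: real)"
    by (rule integral_std_normal_combination) (auto simp: indicator_def)
  then have "(\<integral>x. indicator A (- x) \<partial>\<G>) = (\<integral>x. indicator A x \<partial>\<G> :: real)"
    using std_normal.prob_space by simp
  moreover have "indicator A (- x) = (indicator {x. - x \<in> A} x :: real)" for x
    by (simp add: indicator_def)
  ultimately show ?thesis by simp
qed

lemma std_normal_two_sided:
  assumes "0 \<le> c"
  shows "measure \<G> {x. \<bar>x\<bar> > c} = 2 * (1 - std_normal_cdf c)"
proof -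
  have up: "measure \<G> {c<..} = 1 - std_normal_cdf c"
    using std_normal.prob_compl[of "{..c}"]
    by (simp add: std_normal_cdf_def cdf_def Compl_eq_Diff_UNIV[symmetric])
  have "{x. \<bar>x\<bar> > c} = {c<..} \<union> {x. - x \<in> {c<..}}" using assms by auto
  then have "measure \<G> {x. \<bar>x\<bar> > c} = measure \<G> {c<..} + measure \<G> {x. - x \<in> {c<..}}"
    using assms by (simp only:) (rule std_normal.finite_measure_Union; auto)
  then show ?thesis using up std_normal_reflect[of "{c<..}"] by simp
qed

text \<open>For negative \<open>c\<close> the ray \<open>{..c}\<close> and its reflection would be
  disjoint, each of mass above one half. The critical value is thus nonnegative because \<alpha> is
  below 1.\<close>

lemma std_normal_quantile_nonneg:
  assumes "std_normal_cdf c > 1 / 2"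
  shows "0 \<le> c"
proof (rule ccontr)
  assume "\<not> 0 \<le> c"
  then have "measure \<G> ({..c} \<union> {x. - x \<in> {..c}}) = measure \<G> {..c} + measure \<G> {x. - x \<in> {..c}}"
    by (intro std_normal.finite_measure_Union) auto
  then have "measure \<G> ({..c} \<union> {x. - x \<in> {..c}}) = 2 * std_normal_cdf c"
    using std_normal_reflect[of "{..c}"] by (simp add: std_normal_cdf_def cdf_def)
  then show False using assms std_normal.prob_le_1[of "{..c} \<union> {x. - x \<in> {..c}}"] by simp
qed

lemma joint_tail_le_marginal:
  assumes "\<bar>r\<bar> \<le> 1"
  shows "joint_tail c r \<le> measure \<G> {x. \<bar>x\<bar> > c}"
proof -
  interpret prob_space "bivariate_std_normal r" by (rule prob_space_bivariate_std_normal)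
  have "measure \<G> {x. \<bar>x\<bar> > c} = prob (fst -` {x. \<bar>x\<bar> > c} \<inter> space (bivariate_std_normal r))"
    unfolding marginals_bivariate_std_normal(1)[OF assms, symmetric]
    by (subst measure_distr) auto
  also have "\<dots> \<ge> joint_tail c r"
    unfolding joint_tail_def
  proof (rule finite_measure_mono)
    show "fst -` {x. \<bar>x\<bar> > c} \<inter> space (bivariate_std_normal r) \<in> events"
      by (rule measurable_sets[where A=borel]) auto
  qed auto
  finally show ?thesis .
qed

text \<open>Below \<rho> monotonicity gives the first two terms. From \<rho> on, the marginal bound
  \<open>\<alpha> = \<alpha>\<^sup>2 + \<alpha> * (1 - \<alpha>)\<close> takes over, and
  \<open>R_bound \<rho> c\<close> does no harm: it is nonnegative by monotonicity from correlation
  \<open>0\<close>. The indicator puts both cases into one bound that can be integrated over the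
  draw.\<close>

lemma joint_tail_le:
  assumes \<alpha>: "\<alpha> \<le> 1" and c: "0 \<le> c" "2 * (1 - std_normal_cdf c) = \<alpha>" and \<rho>: "0 \<le> \<rho>" "\<rho> \<le> 1"
    and r: "\<bar>r\<bar> \<le> 1"
  shows "joint_tail c r \<le> \<alpha>\<^sup>2 + R_bound \<rho> c + (\<alpha> * (1 - \<alpha>)) * indicator {\<rho>..} \<bar>r\<bar>"
proof -
  have \<alpha>0: "0 \<le> \<alpha>"
    using std_normal_two_sided[OF c(1)] c(2) measure_nonneg[of \<G> "{x. \<bar>x\<bar> > c}"] by simp
  have tail: "joint_tail c s = R_bound s c + \<alpha>\<^sup>2" if "\<bar>s\<bar> \<le> 1" for s
    using joint_tail_eq_R_bound[OF that c(1)] c(2) by simp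
  \<comment> \<open>At correlation \<open>0\<close> the common part vanishes and
    \<open>cond_tail\<close> is the constant \<alpha>.\<close>
  have z: "joint_tail c 0 = \<alpha>\<^sup>2"
  proof -
    have "cond_tail c 0 z = (\<integral>w. indicator {x. \<bar>x\<bar> > c} w \<partial>\<G>)" for z
      by (simp add: cond_tail_def)
    also have "\<dots> = \<alpha>" using std_normal_two_sided[OF c(1)] c(2) by simp
    finally have "cond_tail c 0 z = \<alpha>" for z .
    then show ?thesis
      using joint_tail_eq_integral[of 0 c] std_normal.prob_space by simp
  qed
  show ?thesis
  proof (cases "\<bar>r\<bar> \<ge> \<rho>")
    case True
    have "\<alpha>\<^sup>2 \<le> joint_tail c \<rho>" using joint_tail_mono[of 0 \<rho> c] \<rho> z by simp
    then have "0 \<le> R_bound \<rho> c" using tail[of \<rho>] \<rho> by simp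
    moreover have "joint_tail c r \<le> \<alpha>"
      using joint_tail_le_marginal[OF r, of c] std_normal_two_sided[OF c(1)] c(2) by simp
    ultimately show ?thesis using True by (simp add: power2_eq_square algebra_simps)
  next
    case False
    then have "joint_tail c r \<le> joint_tail c \<rho>" using \<rho> by (intro joint_tail_mono_abs) auto
    then show ?thesis using False tail[of \<rho>] \<rho> by simp
  qed
qed


section \<open>Conditioning\<close>

text \<open>Mapping \<open>x\<close> to \<open>(s, x)\<close> turns \<open>K s\<close> into a kernel
  on the product space, against which the integrand is one fixed function. The dependence of
  \<open>f\<close> on \<open>s\<close> serves covariances, whose centring means vary with the
  draw.\<close>

lemma borel_measurable_kernel_integral:
  fixes f :: "'s \<Rightarrow> 'b \<Rightarrow> real"
  assumes K[measurable]: "K \<in> N \<rightarrow>\<^sub>M subprob_algebra L"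
    and f[measurable]: "(\<lambda>(s, x). f s x) \<in> borel_measurable (N \<Otimes>\<^sub>M L)"
  shows "(\<lambda>s. \<integral>x. f s x \<partial>K s) \<in> borel_measurable N"
proof -
  note [measurable] = measurable_distr2
  have "(\<lambda>s. integral\<^sup>L (distr (K s) (N \<Otimes>\<^sub>M L) (\<lambda>x. (s, x))) (\<lambda>(s, x). f s x)) \<in> borel_measurable N"
    by measurable
  moreover have "integral\<^sup>L (distr (K s) (N \<Otimes>\<^sub>M L) (\<lambda>x. (s, x))) (\<lambda>(s, x). f s x) = (\<integral>x. f s x \<partial>K s)"
    if "s \<in> space N" for s
  proof -
    have [measurable_cong]: "sets (K s) = sets L" by (rule sets_kernel[OF K that])
    show ?thesis using that by (subst integral_distr) auto
  qed
  ultimately show ?thesis by (simp cong: measurable_cong)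
qed

text \<open>This makes the draws with a large correlation an event, so that its indicator integrates
  to its probability.\<close>

lemma borel_measurable_kernel_correlation:
  assumes K: "K \<in> N \<rightarrow>\<^sub>M subprob_algebra L"
    and [measurable]: "X \<in> borel_measurable L" "Y \<in> borel_measurable L"
  shows "(\<lambda>s. correlation (K s) X Y) \<in> borel_measurable N"
proof -
  have cov: "(\<lambda>s. covariance (K s) f g) \<in> borel_measurable N"
    if [measurable]: "f \<in> borel_measurable L" "g \<in> borel_measurable L" for f g
  proof -
    have [measurable]: "(\<lambda>s. \<integral>x. h x \<partial>K s) \<in> borel_measurable N"
      if "h \<in> borel_measurable L" for h :: "_ \<Rightarrow> real"
      using K that by (intro borel_measurable_kernel_integral) auto
    show ?thesis unfolding covariance_def
      by (rule borel_measurable_kernel_integral[OF K]) measurable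
  qed
  have [measurable]: "(\<lambda>s. covariance (K s) X Y) \<in> borel_measurable N"
    "(\<lambda>s. covariance (K s) X X) \<in> borel_measurable N" "(\<lambda>s. covariance (K s) Y Y) \<in> borel_measurable N"
    by (intro cov; measurable)+
  show ?thesis unfolding correlation_def by measurable
qed

lemma (in prob_space) regular_cond_distr_prob:
  assumes K: "regular_cond_distr M N L S X K" and S: "S \<in> M \<rightarrow>\<^sub>M N"
    and B[measurable]: "B \<in> sets N" and A[measurable]: "A \<in> sets L"
  shows "integrable (distr M N S) (\<lambda>s. indicator B s * measure (K s) A)"
    "prob {\<omega> \<in> space M. S \<omega> \<in> B \<and> X \<omega> \<in> A} = (\<integral>s. indicator B s * measure (K s) A \<partial>distr M N S)"
proof -
  interpret D: prob_space "distr M N S" using S by (rule prob_space_distr)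
  have KK: "K \<in> N \<rightarrow>\<^sub>M prob_algebra L" using K by (simp add: regular_cond_distr_def)
  then have [measurable]: "K \<in> N \<rightarrow>\<^sub>M subprob_algebra L" by (rule measurable_prob_algebraD)
  have ps: "prob_space (K s)" if "s \<in> space N" for s
    using measurable_space[OF KK that] by (simp add: space_prob_algebra)
  have [measurable]: "(\<lambda>s. measure (K s) A) \<in> borel_measurable N" by measurable
  show int: "integrable (distr M N S) (\<lambda>s. indicator B s * measure (K s) A)"
    by (rule D.integrable_const_bound[where B=1])
      (auto simp: indicator_def prob_space.prob_le_1[OF ps])
  have "emeasure M {\<omega> \<in> space M. S \<omega> \<in> B \<and> X \<omega> \<in> A} = (\<integral>\<^sup>+s\<in>B. emeasure (K s) A \<partial>(distr M N S))"
    using K A B by (simp add: regular_cond_distr_def)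
  also have "\<dots> = (\<integral>\<^sup>+s. ennreal (indicator B s * measure (K s) A) \<partial>(distr M N S))"
  proof (rule nn_integral_cong)
    fix s assume "s \<in> space (distr M N S)"
    then interpret Ks: prob_space "K s" by (intro ps) simp
    show "emeasure (K s) A * indicator B s = ennreal (indicator B s * measure (K s) A)"
      by (simp add: Ks.emeasure_eq_measure indicator_def)
  qed
  also have "\<dots> = ennreal (\<integral>s. indicator B s * measure (K s) A \<partial>distr M N S)"
    by (rule nn_integral_eq_integral[OF int]) simp
  finally show "prob {\<omega> \<in> space M. S \<omega> \<in> B \<and> X \<omega> \<in> A} = (\<integral>s. indicator B s * measure (K s) A \<partial>distr M N S)"
    by (simp add: measure_def integral_nonneg_AE)
qed

text \<open>The hypothesis \<open>mean\<close> characterises the conditional expectation of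
  \<open>Y\<close> as the constant \<open>m\<close>, almost surely. The centring inside the
  conditional variance may then be replaced by \<open>m\<close>, and the outer conditional
  expectation disappears on integration.\<close>

lemma (in prob_space) expectation_cond_variance:
  assumes F: "subalgebra M F" and Y: "integrable M Y" "integrable M (\<lambda>\<omega>. (Y \<omega> - m)\<^sup>2)"
    and mean: "\<And>A. A \<in> sets F \<Longrightarrow> (\<integral>\<omega>. indicator A \<omega> * Y \<omega> \<partial>M) = m * prob A"
  shows "(\<integral>\<omega>. cond_variance M F Y \<omega> \<partial>M) = (\<integral>\<omega>. (Y \<omega> - m)\<^sup>2 \<partial>M)"
proof -
  interpret finite_measure_subalgebra M F using F by unfold_locales
  have [measurable]: "Y \<in> borel_measurable M" using Y(1) by simp
  have "AE \<omega> in M. real_cond_exp M F Y \<omega> = m"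
  proof (rule real_cond_exp_charact)
    fix A assume A: "A \<in> sets F"
    then have "A \<in> sets M" using F by (auto simp: subalgebra_def)
    then show "(\<integral>\<omega>\<in>A. Y \<omega> \<partial>M) = (\<integral>\<omega>\<in>A. m \<partial>M)"
      using mean[OF A] by (simp add: set_lebesgue_integral_def)
  qed (use Y in auto)
  then have ae: "AE \<omega> in M. (Y \<omega> - m)\<^sup>2 = (Y \<omega> - real_cond_exp M F Y \<omega>)\<^sup>2" by auto
  have "integrable M (\<lambda>\<omega>. (Y \<omega> - real_cond_exp M F Y \<omega>)\<^sup>2)"
    by (rule integrable_cong_AE_imp[OF Y(2)]) (use ae in auto)
  then have "(\<integral>\<omega>. cond_variance M F Y \<omega> \<partial>M) = (\<integral>\<omega>. (Y \<omega> - real_cond_exp M F Y \<omega>)\<^sup>2 \<partial>M)"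
    unfolding cond_variance_def by (rule real_cond_exp_int(2))
  also have "\<dots> = (\<integral>\<omega>. (Y \<omega> - m)\<^sup>2 \<partial>M)"
    by (rule integral_cong_AE) (use ae in auto)
  finally show ?thesis .
qed

text \<open>Linear combinations of two coordinates are those of the whole vector with all other
  coefficients zero, so the pair inherits normality and its correlation alone fixes its law.\<close>

lemma joint_law_of_jointly_normal:
  fixes \<mu> :: "('i \<Rightarrow> real) measure"
  assumes "prob_space \<mu>" and s[measurable_cong]: "sets \<mu> = sets (\<Pi>\<^sub>M i\<in>I. borel)"
    and I: "finite I" "i \<in> I" "j \<in> I" "i \<noteq> j"
    and normal: "jointly_normal I \<mu>"
    and marg: "distr \<mu> borel (\<lambda>x. x i) = \<G>" "distr \<mu> borel (\<lambda>x. x j) = \<G>"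
  defines "r \<equiv> correlation \<mu> (\<lambda>x. x i) (\<lambda>x. x j)"
  shows "\<bar>r\<bar> \<le> 1" "distr \<mu> (borel \<Otimes>\<^sub>M borel) (\<lambda>x. (x i, x j)) = bivariate_std_normal r"
proof -
  interpret prob_space \<mu> by fact
  have [measurable]: "(\<lambda>x. x i) \<in> borel_measurable \<mu>" "(\<lambda>x. x j) \<in> borel_measurable \<mu>"
    using I by measurable
  have lin: "\<exists>m \<sigma>. \<sigma> \<ge> 0 \<and> distr \<mu> borel (\<lambda>x. a * x i + b * x j) = normal_law m \<sigma>" for a b
  proof -
    let ?a = "\<lambda>k. (if k = i then a else 0) + (if k = j then b else 0)"
    have "(\<Sum>k\<in>I. ?a k * x k) = a * x i + b * x j" for x :: "'i \<Rightarrow> real"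
      using I by (simp add: ring_distribs sum.distrib if_distrib[of "\<lambda>y. y * _"] cong: if_cong)
    then show ?thesis using normal[unfolded jointly_normal_def, rule_format, of ?a] by simp
  qed
  have 1: "(\<lambda>x. x i) \<in> borel_measurable \<mu>" "(\<lambda>x. x j) \<in> borel_measurable \<mu>" by measurable
  note * = joint_law_std_normal[OF 1 marg lin]
  show "\<bar>r\<bar> \<le> 1" "distr \<mu> (borel \<Otimes>\<^sub>M borel) (\<lambda>x. (x i, x j)) = bivariate_std_normal r"
    using *(1,2) unfolding r_def *(3) by blast+
qed

theorem corollary3:
  fixes M :: "'a measure" and N :: "'s measure"
    and S :: "'a \<Rightarrow> 's" and T :: "nat \<Rightarrow> 'a \<Rightarrow> real"
    and K :: "'s \<Rightarrow> (nat \<Rightarrow> real) measure"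
    and C :: nat and \<alpha> \<rho>0 c w :: real
  assumes alpha: "0 < \<alpha>" "\<alpha> < 1"
    and C: "C \<ge> 2"
    and rho0: "0 \<le> \<rho>0" "\<rho>0 \<le> 1"
    and c: "std_normal_cdf c = 1 - \<alpha> / 2"
    and prob: "prob_space M"
    and S: "S \<in> M \<rightarrow>\<^sub>M N"
    and T: "\<And>i. i \<in> {1..C} \<Longrightarrow> T i \<in> borel_measurable M"
    and K: "regular_cond_distr M N (\<Pi>\<^sub>M i\<in>{1..C}. borel) S (\<lambda>\<omega>. \<lambda>i\<in>{1..C}. T i \<omega>) K"
    and normal: "AE s in distr M N S. jointly_normal {1..C} (K s)"
    and marginal: "\<And>i. i \<in> {1..C} \<Longrightarrow>
      AE s in distr M N S. distr (K s) borel (\<lambda>x. x i) = std_normal_distribution"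
    and corr: "\<And>i j. i \<in> {1..C} \<Longrightarrow> j \<in> {1..C} \<Longrightarrow> i \<noteq> j \<Longrightarrow>
      measure (distr M N S)
        {s\<in>space N. \<bar>correlation (K s) (\<lambda>x. x i) (\<lambda>x. x j)\<bar> \<ge> \<rho>0} \<le> w"
  shows "EVR M N S C \<alpha> (num_rejections M C T c) \<le>
    1 + (real C - 1) / (\<alpha> * (1 - \<alpha>)) * (\<alpha> * (1 - \<alpha>) * w + R_bound \<rho>0 c)"
proof -
  interpret prob_space M by fact
  interpret D: prob_space "distr M N S" using S by (rule prob_space_distr)
  let ?L = "\<Pi>\<^sub>M i\<in>{1..C}. (borel :: real measure)"
  let ?E = "num_rejections M C T c"
  let ?b = "\<alpha>\<^sup>2 + R_bound \<rho>0 c + \<alpha> * (1 - \<alpha>) * w"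
  have c2: "2 * (1 - std_normal_cdf c) = \<alpha>" using c by simp
  have c0: "0 \<le> c" by (rule std_normal_quantile_nonneg) (use c alpha in simp)
  have KK: "K \<in> N \<rightarrow>\<^sub>M prob_algebra ?L" using K by (simp add: regular_cond_distr_def)
  then have Ks[measurable]: "K \<in> N \<rightarrow>\<^sub>M subprob_algebra ?L" by (rule measurable_prob_algebraD)
  have ps: "prob_space (K s)" and sK: "sets (K s) = sets ?L" if "s \<in> space N" for s
    using measurable_space[OF KK that] by (simp_all add: space_prob_algebra)
  have spL: "space (K s) = space ?L" if "s \<in> space N" for s
    by (rule sets_eq_imp_space_eq[OF sK[OF that]])
  have comp[measurable]: "(\<lambda>x. x i) \<in> borel_measurable ?L" if "i \<in> {1..C}" for i
    using that by (rule measurable_component_singleton)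
  have R[measurable]: "reject M T c i \<in> sets M" if "i \<in> {1..C}" for i
  proof -
    have [measurable]: "T i \<in> borel_measurable M" by (rule T[OF that])
    show ?thesis unfolding reject_def by measurable
  qed
  define A where "A i = {x \<in> space ?L. \<bar>x i\<bar> > c}" for i
  have A[measurable]: "A i \<in> sets ?L" if "i \<in> {1..C}" for i
    unfolding A_def using comp[OF that] by measurable
  \<comment> \<open>Only coordinates in the index set are inspected, where the restricted vector
    agrees with \<open>T\<close>. The case \<open>i = j\<close> gives the event of a single
    rejection.\<close>
  have RA: "S -` B \<inter> reject M T c i \<inter> reject M T c j =
      {\<omega> \<in> space M. S \<omega> \<in> B \<and> (\<lambda>i\<in>{1..C}. T i \<omega>) \<in> A i \<inter> A j}"
    if "i \<in> {1..C}" "j \<in> {1..C}" for B i j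
    using that by (auto simp: reject_def A_def space_PiM)

  \<comment> \<open>Rejection probabilities given the draw: one test, then a pair\<close>
  have meas_Ai: "AE s in distr M N S. measure (K s) (A i) = \<alpha>" if i: "i \<in> {1..C}" for i
    using marginal[OF i] AE_space
  proof eventually_elim
    case (elim s)
    then have s: "s \<in> space N" by simp
    have [measurable_cong]: "sets (K s) = sets ?L" by (rule sK[OF s])
    have [measurable]: "(\<lambda>x. x i) \<in> borel_measurable (K s)"
      using comp[OF i] by (simp cong: measurable_cong_sets add: sK[OF s])
    have "measure \<G> {x. \<bar>x\<bar> > c} = measure (K s) (A i)"
      unfolding elim(1)[symmetric] A_def
      by (subst measure_distr) (auto intro!: arg_cong2[where f=measure] simp: spL[OF s])
    then show ?case using std_normal_two_sided[OF c0] c2 by simp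
  qed
  \<comment> \<open>As \<open>B\<close> is arbitrary, the conditional probability of rejection given
    \<open>S\<close> is the constant \<alpha>; summed over the tests, this later supplies the
    hypothesis \<open>mean\<close> of \<open>expectation_cond_variance\<close>.\<close>
  have cond_prob: "prob (S -` B \<inter> reject M T c i) = \<alpha> * prob (S -` B \<inter> space M)"
    if i: "i \<in> {1..C}" and B[measurable]: "B \<in> sets N" for i B
  proof -
    have "prob (S -` B \<inter> reject M T c i) = (\<integral>s. indicator B s * measure (K s) (A i) \<partial>distr M N S)"
      using regular_cond_distr_prob(2)[OF K S B A[OF i]] RA[OF i i, of B] by (simp add: Int_assoc)
    also have "\<dots> = (\<integral>s. indicator B s * \<alpha> \<partial>distr M N S)"
    proof (rule integral_cong_AE)
      show "(\<lambda>s. indicator B s * measure (K s) (A i)) \<in> borel_measurable (distr M N S)"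
        using A[OF i] by measurable
    qed (use meas_Ai[OF i] in auto)
    also have "\<dots> = \<alpha> * prob (S -` B \<inter> space M)"
      using S by (simp add: measure_distr)
    finally show ?thesis .
  qed
  have joint: "prob (reject M T c i \<inter> reject M T c j) \<le> ?b"
    if i: "i \<in> {1..C}" and j: "j \<in> {1..C}" and ij: "i \<noteq> j" for i j
  proof -
    define r where "r s = correlation (K s) (\<lambda>x. x i) (\<lambda>x. x j)" for s
    have [measurable]: "(\<lambda>x. x i) \<in> borel_measurable ?L" "(\<lambda>x. x j) \<in> borel_measurable ?L"
      by (rule comp[OF i] comp[OF j])+
    have [measurable]: "r \<in> borel_measurable N"
      unfolding r_def by (rule borel_measurable_kernel_correlation[OF Ks]) measurable
    have Aij: "A i \<inter> A j \<in> sets ?L" using A[OF i] A[OF j] by measurable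
    \<comment> \<open>The factor \<open>indicator (space N) s\<close> is \<open>1\<close> on every
      draw; it matches \<open>regular_cond_distr_prob\<close> with
      \<open>B = space N\<close>.\<close>
    have bound: "AE s in distr M N S. indicator (space N) s * measure (K s) (A i \<inter> A j) \<le>
      \<alpha>\<^sup>2 + R_bound \<rho>0 c + (\<alpha> * (1 - \<alpha>)) * indicator {s \<in> space N. \<rho>0 \<le> \<bar>r s\<bar>} s"
      using normal marginal[OF i] marginal[OF j] AE_space
    proof eventually_elim
      case (elim s)
      then have s: "s \<in> space N" by simp
      have [measurable]: "(\<lambda>x. x i) \<in> borel_measurable (K s)" "(\<lambda>x. x j) \<in> borel_measurable (K s)"
        using comp[OF i] comp[OF j] by (simp_all cong: measurable_cong_sets add: sK[OF s])
      note law = joint_law_of_jointly_normal[OF ps[OF s] sK[OF s] finite_atLeastAtMost i j ij elim(1-3), folded r_def]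
      have "joint_tail c (r s) = measure (K s) (A i \<inter> A j)"
        unfolding joint_tail_def law(2)[symmetric]
        by (subst measure_distr) (auto intro!: arg_cong2[where f=measure] simp: A_def spL[OF s])
      then show ?case
        using joint_tail_le[OF _ c0 c2 rho0 law(1)] alpha s by (simp add: indicator_def)
    qed
    have "prob (reject M T c i \<inter> reject M T c j) = prob (S -` space N \<inter> reject M T c i \<inter> reject M T c j)"
      using measurable_space[OF S] by (intro arg_cong[where f=prob]) (auto simp: reject_def)
    also have "\<dots> = (\<integral>s. indicator (space N) s * measure (K s) (A i \<inter> A j) \<partial>distr M N S)"
      unfolding RA[OF i j] by (rule regular_cond_distr_prob(2)[OF K S sets.top Aij])
    also have "\<dots> \<le> (\<integral>s. \<alpha>\<^sup>2 + R_bound \<rho>0 c + (\<alpha> * (1 - \<alpha>)) * indicator {s \<in> space N. \<rho>0 \<le> \<bar>r s\<bar>} s \<partial>distr M N S)"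
      by (rule integral_mono_AE[OF regular_cond_distr_prob(1)[OF K S sets.top Aij] _ bound])
        (auto intro!: D.integrable_const_bound[where B="\<bar>\<alpha>\<^sup>2 + R_bound \<rho>0 c\<bar> + \<bar>\<alpha> * (1 - \<alpha>)\<bar>"] simp: indicator_def)
    also have "\<dots> = \<alpha>\<^sup>2 + R_bound \<rho>0 c + (\<alpha> * (1 - \<alpha>)) * measure (distr M N S) {s \<in> space N. \<rho>0 \<le> \<bar>r s\<bar>}"
    proof -
      have "{s \<in> space N. \<rho>0 \<le> \<bar>r s\<bar>} \<in> sets N" by measurable
      then show ?thesis
        using D.prob_space by (subst Bochner_Integration.integral_add) (auto simp: Int_absorb2 intro!: D.integrable_const_bound[where B=1])
    qed
    also have "\<dots> \<le> ?b"
      using corr[OF i j ij] alpha by (intro add_left_mono mult_left_mono) (simp_all add: r_def)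
    finally show ?thesis .
  qed

  \<comment> \<open>Mean and expected conditional variance of the rejection count\<close>
  have E_eq: "?E \<omega> = (\<Sum>i=1..C. indicator (reject M T c i) \<omega>)" for \<omega>
    by (simp add: num_rejections_def)
  have iR: "integrable M (\<lambda>\<omega>. indicator A \<omega> :: real)" if "A \<in> sets M" for A
    using that by (simp add: emeasure_eq_measure)
  have intE: "integrable M ?E" unfolding E_eq using R by (intro Bochner_Integration.integrable_sum iR) auto
  have E2: "(?E \<omega> - real C * \<alpha>)\<^sup>2 =
      (\<Sum>i=1..C. \<Sum>j=1..C. indicator (reject M T c i \<inter> reject M T c j) \<omega>)
      - 2 * (real C * \<alpha>) * ?E \<omega> + (real C * \<alpha>)\<^sup>2" for \<omega>
    by (simp add: power2_diff) (simp add: E_eq power2_eq_square sum_product indicator_inter_arith algebra_simps)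
  have intS: "integrable M (\<lambda>\<omega>. \<Sum>i=1..C. \<Sum>j=1..C. indicator (reject M T c i \<inter> reject M T c j) \<omega> :: real)"
    using R by (intro Bochner_Integration.integrable_sum iR) auto
  have pR: "prob (reject M T c i) = \<alpha>" if "i \<in> {1..C}" for i
  proof -
    have "S -` space N \<inter> reject M T c i = reject M T c i" "S -` space N \<inter> space M = space M"
      using measurable_space[OF S] by (auto simp: reject_def)
    then show ?thesis using cond_prob[OF that sets.top] prob_space by simp
  qed
  have expE: "expectation ?E = real C * \<alpha>"
    unfolding E_eq using R pR by (subst Bochner_Integration.integral_sum) (auto intro: iR)
  have SC: "S \<in> space M \<rightarrow> space N" using measurable_space[OF S] by auto
  have F: "subalgebra M (sigma_gen M N S)"
    using S unfolding subalgebra_def sigma_gen_def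
    by (auto simp: sets_vimage_algebra2[OF SC])
  have "(\<integral>\<omega>. cond_variance M (sigma_gen M N S) ?E \<omega> \<partial>M) = (\<integral>\<omega>. (?E \<omega> - real C * \<alpha>)\<^sup>2 \<partial>M)"
  proof (rule expectation_cond_variance[OF F intE])
    show "integrable M (\<lambda>\<omega>. (?E \<omega> - real C * \<alpha>)\<^sup>2)"
      unfolding E2 using intS intE by auto
    fix G assume "G \<in> sets (sigma_gen M N S)"
    then obtain B where B: "B \<in> sets N" and G: "G = S -` B \<inter> space M"
      unfolding sigma_gen_def sets_vimage_algebra2[OF SC] by auto
    have GM: "G \<in> sets M" unfolding G using S B by measurable
    have "(\<integral>\<omega>. indicator G \<omega> * ?E \<omega> \<partial>M) = (\<integral>\<omega>. (\<Sum>i=1..C. indicator (G \<inter> reject M T c i) \<omega>) \<partial>M)"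
      by (simp add: E_eq sum_distrib_left indicator_inter_arith)
    also have "\<dots> = (\<Sum>i=1..C. prob (G \<inter> reject M T c i))"
      using R GM by (subst Bochner_Integration.integral_sum) (auto intro!: iR sum.cong)
    also have "\<dots> = (\<Sum>i=1..C. \<alpha> * prob G)"
    proof (rule sum.cong[OF refl])
      fix i assume i: "i \<in> {1..C}"
      have "G \<inter> reject M T c i = S -` B \<inter> reject M T c i" by (auto simp: G reject_def)
      then show "prob (G \<inter> reject M T c i) = \<alpha> * prob G" using cond_prob[OF i B] G by simp
    qed
    finally show "(\<integral>\<omega>. indicator G \<omega> * ?E \<omega> \<partial>M) = real C * \<alpha> * prob G" by simp
  qed
  also have "\<dots> = (\<Sum>i=1..C. \<Sum>j=1..C. prob (reject M T c i \<inter> reject M T c j)) - (real C * \<alpha>)\<^sup>2"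
  proof -
    have "(\<integral>\<omega>. (\<Sum>i=1..C. \<Sum>j=1..C. indicator (reject M T c i \<inter> reject M T c j) \<omega>) \<partial>M) =
      (\<Sum>i=1..C. \<Sum>j=1..C. prob (reject M T c i \<inter> reject M T c j))"
      using R by (subst Bochner_Integration.integral_sum, force intro!: Bochner_Integration.integrable_sum iR,
          intro sum.cong refl, subst Bochner_Integration.integral_sum) (auto intro!: iR sum.cong)
    then show ?thesis unfolding E2 using intS intE expE prob_space
      by (simp add: power2_eq_square)
  qed
  \<comment> \<open>A diagonal term is the marginal probability \<alpha>; each of the other
    \<open>C - 1\<close> terms in a row is at most \<open>?b\<close>.\<close>
  also have "(\<Sum>i=1..C. \<Sum>j=1..C. prob (reject M T c i \<inter> reject M T c j)) \<le>
      (\<Sum>i=1..C. \<Sum>j=1..C. if j = i then \<alpha> else ?b)"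
    by (intro sum_mono) (use joint pR in auto)
  also have "(\<Sum>i=1..C. \<Sum>j=1..C. if j = i then \<alpha> else ?b) = real C * (\<alpha> + (real C - 1) * ?b)"
  proof -
    have "(\<Sum>j=1..C. if j = i then \<alpha> else ?b) = \<alpha> + (real C - 1) * ?b" if "i \<in> {1..C}" for i
      using that C by (subst sum.remove[of _ i]) (auto simp: of_nat_diff)
    then show ?thesis by simp
  qed
  finally have "(\<integral>\<omega>. cond_variance M (sigma_gen M N S) ?E \<omega> \<partial>M) \<le>
    real C * (\<alpha> + (real C - 1) * ?b) - (real C * \<alpha>)\<^sup>2" by simp
  \<comment> \<open>The \<open>C * (C - 1)\<close> copies of \<open>\<alpha>\<^sup>2\<close> inside
    \<open>?b\<close>, together with \<open>C * \<alpha>\<close> and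
    \<open>- (C * \<alpha>)\<^sup>2\<close>, leave \<open>C * \<alpha> * (1 - \<alpha>)\<close>.
    This is the variance for independent tests and the source of the leading
    \<open>1\<close>.\<close>
  also have "\<dots> = (real C * \<alpha> * (1 - \<alpha>)) *
    (1 + (real C - 1) / (\<alpha> * (1 - \<alpha>)) * (\<alpha> * (1 - \<alpha>) * w + R_bound \<rho>0 c))"
    using alpha by (simp add: divide_simps) (simp add: algebra_simps power2_eq_square)
  finally show ?thesis
    unfolding EVR_def using alpha C by (simp add: pos_divide_le_eq mult.commute)
qed

end
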